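(* Let $K$ be an algebraically closed field of characteristic $0$, let $n\ge1$, and let $A_n,B_n,G_n:\mathbb{A}^2\to\mathbb{A}^2$ be the $n$th folding maps associated to the Lie algebras $\mathcal{A}_2$, $\mathcal{B}_2$, $\mathcal{G}_2$, respectively. (a) Let $\overline{A}_n(X,Y,Z)$ be the homogenization of $A_n$. Then $\overline{A}_n:\mathbb{P}^2\to\mathbb{P}^2$ is a morphism of degree $n$. (b) Let $\overline{B}_n(X,Y,Z)$ be the homogenization of $B_n$. Then $\overline{B}_n:\mathbb{P}^2\to\mathbb{P}^2$ is a morphism of degree $n$. (c) Let $\overline{G}_n(X,Y,Z)$ be the homogenization of $G_n$. Then $\overline{G}_n:\mathbb{P}^2\dashrightarrow\mathbb{P}^2$ is a rational map of degree $\left\lfloor\frac{3n}{2}\right\rfloor$. If $n\ge2$, then $\overline{G}_n$ is not a morphism, and its indeterminacy locus is $$I(\overline{G}_n)=\begin{cases}\{[0,1,0]\}&\text{if $n$ is even},\\ \{[0,1,0],[1,0,0]\}&\text{if $n$ is odd}.\end{cases}$$ The dynamical degree of $\overline{G}_n$ is $\operatorname{DynDeg}(\overline{G}_n)=n$.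
   Context: The homogenization of a polynomial map $f=(f_1,f_2):\mathbb{A}^2\to\mathbb{A}^2$, with $d=\max(\deg f_1,\deg f_2)$ (total degrees), is the rational map $\bar f=[Z^df_1(X/Z,Y/Z),\,Z^df_2(X/Z,Y/Z),\,Z^d]$ of $\mathbb{P}^2$. The degree of a rational map of $\mathbb{P}^2$ is the common degree of homogeneous polynomials without common factor defining it; its indeterminacy locus $I(\cdot)$ is the set of common zeros in $\mathbb{P}^2$ of these polynomials. The dynamical degree of $f$ is $\operatorname{DynDeg}(f)=\lim_{m\to\infty}(\deg f^m)^{1/m}$, where $f^m$ is the $m$th iterate. In each of the three cases the folding map is written $(X_n,Y_n)$ with $X_n,Y_n\in\mathbb{Z}[x,y]$, and is given explicitly as follows. $A_n$: $(X_0,Y_0)=(3,0)$, $(X_1,Y_1)=(x,y)$, $(X_2,Y_2)=(x^2-y^2-2x,\ 2xy+2y)$, and for $n\ge3$ $$X_n=x(X_{n-1}-X_{n-2})-y(Y_{n-1}+Y_{n-2})+X_{n-3},\qquad Y_n=x(Y_{n-1}-Y_{n-2})+y(X_{n-1}+X_{n-2})+Y_{n-3}.$$ $B_n$: $(X_0,Y_0)=(4,4)$, $(X_1,Y_1)=(x,y)$, $(X_2,Y_2)=(x^2-2y-4,\ y^2-2x^2+4y+4)$, $(X_3,Y_3)=(x^3-3xy-3x,\ y^3-3x^2y+6y^2+9y)$, and for $n\ge0$ $$X_{n+4}=x(X_{n+3}+X_{n+1})-(2+y)X_{n+2}-X_n,\qquad Y_{n+4}=y(Y_{n+3}+Y_{n+1})-(x^2-2y-2)Y_{n+2}-Y_n.$$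 $G_n$: $X_0=6$, $Y_0=6$; $X_1=x$, $Y_1=y$; $X_2=x^2-2x-2y-6$, $Y_2=-2x^3+6xy+y^2+18x+10y+18$; $X_3=x^3-3xy-9x-6y-12$, $Y_3=-3x^3y-6x^3+9xy^2+y^3+45xy+18y^2+54x+63y+60$; $X_4=x^4-4x^2y-10x^2-4xy+2y^2-8x+8y+6$, $Y_4=2x^6-12x^4y-4x^3y^2-36x^4-28x^3y+18x^2y^2+12xy^3+y^4-40x^3+108x^2y+120xy^2+24y^3+162x^2+372xy+134y^2+360x+280y+198$; $X_5=x^5-5x^3y-15x^3-5x^2y+5xy^2-10x^2+35xy+10y^2+55x+50y+60$, $Y_5=5x^6y+10x^6-30x^4y^2-5x^3y^3-150x^4y-65x^3y^2+45x^2y^3+15xy^4+y^5-180x^4-205x^3y+360x^2y^2+240xy^3+30y^4-190x^3+945x^2y+1200xy^2+255y^3+810x^2+2415xy+920y^2+1710x+1495y+900$; and for $n\ge0$ $$X_{n+6}=x(X_{n+5}+X_{n+1})-(x+y+3)(X_{n+4}+X_{n+2})+(x^2-2y-4)X_{n+3}-X_n,$$ $$Y_{n+6}=y(Y_{n+5}+Y_{n+1})-(x^3-3xy-9x-5y-9)(Y_{n+4}+Y_{n+2})+(y^2-2x^3+6xy+18x+12y+20)Y_{n+3}-Y_n.$$ The folding maps satisfy $A_m\circ A_n=A_{mn}$, $B_m\circ B_n=B_{mn}$ and $G_m\circ G_n=G_{mn}$ for all $m,n$ (a known fact). *)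

theory Defs
  imports Complex_Main "HOL-Computational_Algebra.Polynomial"
begin

section \<open>Polynomials in two and three variables\<close>

text \<open>
  \<open>K[x,y]\<close> is rendered as \<open>K[x][y]\<close> and \<open>K[X,Y,Z]\<close> as \<open>K[X][Y][Z]\<close>; the last variable is
  always the outermost one.
\<close>

type_synonym 'a poly2 = "'a poly poly"
type_synonym 'a poly3 = "'a poly poly poly"

definition var_x :: "'a::comm_ring_1 poly2" where "var_x = [:[:0, 1:]:]"
definition var_y :: "'a::comm_ring_1 poly2" where "var_y = [:0, 1:]"

definition coeff2 :: "'a::zero poly2 \<Rightarrow> nat \<Rightarrow> nat \<Rightarrow> 'a" where
  "coeff2 p i j = coeff (coeff p j) i"

definition coeff3 :: "'a::zero poly3 \<Rightarrow> nat \<Rightarrow> nat \<Rightarrow> nat \<Rightarrow> 'a" where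
  "coeff3 F i j k = coeff (coeff (coeff F k) j) i"

definition monom3 :: "'a::zero \<Rightarrow> nat \<Rightarrow> nat \<Rightarrow> nat \<Rightarrow> 'a poly3" where
  "monom3 a i j k = monom (monom (monom a i) j) k"

text \<open>The zero polynomial gets total degree 0, as for \<^const>\<open>degree\<close>.\<close>

definition total_degree2 :: "'a::zero poly2 \<Rightarrow> nat" where
  "total_degree2 p = Max (insert 0 {i + j | i j. coeff2 p i j \<noteq> 0})"

definition homogeneous3 :: "nat \<Rightarrow> 'a::zero poly3 \<Rightarrow> bool" where
  "homogeneous3 d F \<longleftrightarrow> (\<forall>i j k. coeff3 F i j k \<noteq> 0 \<longrightarrow> i + j + k = d)"

definition eval3 :: "'a::comm_ring_1 poly3 \<Rightarrow> 'a \<times> 'a \<times> 'a \<Rightarrow> 'a" where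
  "eval3 F = (\<lambda>(x, y, z). poly (poly (poly F [:[:z:]:]) [:y:]) x)"

definition subst3 :: "'a::comm_ring_1 poly3 \<Rightarrow> 'a poly3 \<times> 'a poly3 \<times> 'a poly3 \<Rightarrow> 'a poly3" where
  "subst3 F = (\<lambda>(G\<^sub>0, G\<^sub>1, G\<^sub>2).
     \<Sum>k\<le>degree F. \<Sum>j\<le>degree (coeff F k). \<Sum>i\<le>degree (coeff (coeff F k) j).
       monom3 (coeff3 F i j k) 0 0 0 * G\<^sub>0 ^ i * G\<^sub>1 ^ j * G\<^sub>2 ^ k)"

section \<open>The projective plane\<close>

definition proj_rel :: "'a::field \<times> 'a \<times> 'a \<Rightarrow> 'a \<times> 'a \<times> 'a \<Rightarrow> bool" where
  "proj_rel = (\<lambda>(x, y, z) (x', y', z'). (x, y, z) \<noteq> (0, 0, 0) \<and> (x', y', z') \<noteq> (0, 0, 0) \<and>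
     (\<exists>c. c \<noteq> 0 \<and> x' = c * x \<and> y' = c * y \<and> z' = c * z))"

lemma part_equivp_proj_rel: "part_equivp (proj_rel :: 'a::field \<times> 'a \<times> 'a \<Rightarrow> _)"
proof (rule part_equivpI)
  have "proj_rel (1, 0, 0) (1 :: 'a, 0, 0)"
    by (auto simp: proj_rel_def intro: exI[of _ 1])
  then show "\<exists>u :: 'a \<times> 'a \<times> 'a. proj_rel u u" by blast
  show "symp (proj_rel :: 'a \<times> 'a \<times> 'a \<Rightarrow> _)"
  proof (rule sympI)
    fix u v :: "'a \<times> 'a \<times> 'a"
    assume uv: "proj_rel u v"
    obtain x y z where u: "u = (x, y, z)" by (cases u)
    obtain x' y' z' where v: "v = (x', y', z')" by (cases v)
    from uv obtain c where "c \<noteq> 0" "x' = c * x" "y' = c * y" "z' = c * z"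
      by (auto simp: proj_rel_def u v)
    then have "inverse c \<noteq> 0 \<and> x = inverse c * x' \<and> y = inverse c * y' \<and> z = inverse c * z'"
      by simp
    with uv show "proj_rel v u"
      unfolding proj_rel_def u v prod.case by blast
  qed
  show "transp (proj_rel :: 'a \<times> 'a \<times> 'a \<Rightarrow> _)"
  proof (rule transpI)
    fix u v w :: "'a \<times> 'a \<times> 'a"
    assume uv: "proj_rel u v" and vw: "proj_rel v w"
    obtain x y z where u: "u = (x, y, z)" by (cases u)
    obtain x' y' z' where v: "v = (x', y', z')" by (cases v)
    obtain x'' y'' z'' where w: "w = (x'', y'', z'')" by (cases w)
    from uv obtain c where c: "c \<noteq> 0" "x' = c * x" "y' = c * y" "z' = c * z"
      by (auto simp: proj_rel_def u v)
    from vw obtain b where b: "b \<noteq> 0" "x'' = b * x'" "y'' = b * y'" "z'' = b * z'"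
      by (auto simp: proj_rel_def v w)
    have "b * c \<noteq> 0 \<and> x'' = (b * c) * x \<and> y'' = (b * c) * y \<and> z'' = (b * c) * z"
      using b c by simp
    moreover have "u \<noteq> (0, 0, 0)" "w \<noteq> (0, 0, 0)"
      using uv vw by (auto simp: proj_rel_def u v w)
    ultimately show "proj_rel u w"
      unfolding proj_rel_def u w prod.case by blast
  qed
qed

quotient_type (overloaded) 'a proj_plane = "'a::field \<times> 'a \<times> 'a" / partial: proj_rel
  by (rule part_equivp_proj_rel)

text \<open>The point \<open>[x, y, z]\<close>; only meaningful when the coordinates are not all zero.\<close>

definition proj_point :: "'a::field \<Rightarrow> 'a \<Rightarrow> 'a \<Rightarrow> 'a proj_plane" where
  "proj_point x y z = abs_proj_plane (x, y, z)"

section \<open>Rational maps of the projective plane\<close>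

text \<open>
  A rational map of the projective plane is represented by a triple of homogeneous polynomials of
  the same degree, not all zero. Two triples represent the same rational map iff they are
  proportional over the function field, i.e. iff all their \<open>2 \<times> 2\<close> minors vanish.
\<close>

type_synonym 'a triple = "'a poly3 \<times> 'a poly3 \<times> 'a poly3"

definition homogeneous_triple :: "nat \<Rightarrow> 'a::field triple \<Rightarrow> bool" where
  "homogeneous_triple d = (\<lambda>(F\<^sub>0, F\<^sub>1, F\<^sub>2).
     homogeneous3 d F\<^sub>0 \<and> homogeneous3 d F\<^sub>1 \<and> homogeneous3 d F\<^sub>2 \<and> (F\<^sub>0, F\<^sub>1, F\<^sub>2) \<noteq> (0, 0, 0))"

definition rational_map :: "'a::field triple \<Rightarrow> bool" where
  "rational_map F \<longleftrightarrow> (\<exists>d. homogeneous_triple d F)"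

definition same_map :: "'a::field triple \<Rightarrow> 'a triple \<Rightarrow> bool" where
  "same_map = (\<lambda>(F\<^sub>0, F\<^sub>1, F\<^sub>2) (G\<^sub>0, G\<^sub>1, G\<^sub>2).
     rational_map (F\<^sub>0, F\<^sub>1, F\<^sub>2) \<and> rational_map (G\<^sub>0, G\<^sub>1, G\<^sub>2) \<and>
     F\<^sub>0 * G\<^sub>1 = F\<^sub>1 * G\<^sub>0 \<and> F\<^sub>0 * G\<^sub>2 = F\<^sub>2 * G\<^sub>0 \<and> F\<^sub>1 * G\<^sub>2 = F\<^sub>2 * G\<^sub>1)"

definition no_common_factor :: "'a::field triple \<Rightarrow> bool" where
  "no_common_factor = (\<lambda>(F\<^sub>0, F\<^sub>1, F\<^sub>2). \<forall>h. h dvd F\<^sub>0 \<and> h dvd F\<^sub>1 \<and> h dvd F\<^sub>2 \<longrightarrow> is_unit h)"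

definition zero_locus :: "'a::field triple \<Rightarrow> 'a proj_plane set" where
  "zero_locus = (\<lambda>(F\<^sub>0, F\<^sub>1, F\<^sub>2). {proj_point x y z | x y z. (x, y, z) \<noteq> (0, 0, 0) \<and>
     eval3 F\<^sub>0 (x, y, z) = 0 \<and> eval3 F\<^sub>1 (x, y, z) = 0 \<and> eval3 F\<^sub>2 (x, y, z) = 0})"

text \<open>
  Triples without common factor representing a given rational map exist and agree up to a nonzero
  constant, so neither the degree nor the indeterminacy locus depends on which one is used.
\<close>

definition rmap_degree :: "'a::field triple \<Rightarrow> nat" where
  "rmap_degree F = (THE d. \<exists>G. same_map F G \<and> no_common_factor G \<and> homogeneous_triple d G)"

definition indeterminacy_locus :: "'a::field triple \<Rightarrow> 'a proj_plane set" where
  "indeterminacy_locus F = {P. \<exists>G. same_map F G \<and> no_common_factor G \<and> P \<in> zero_locus G}"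

text \<open>
  A rational map is regular at a point if some triple representing it (with or without common
  factor) does not vanish identically there; it is a morphism if it is regular everywhere.
\<close>

definition regular_at :: "'a::field triple \<Rightarrow> 'a proj_plane \<Rightarrow> bool" where
  "regular_at F P \<longleftrightarrow> (\<exists>G. same_map F G \<and> P \<notin> zero_locus G)"

definition is_morphism :: "'a::field triple \<Rightarrow> bool" where
  "is_morphism F \<longleftrightarrow> rational_map F \<and> (\<forall>P. regular_at F P)"

definition rmap_id :: "'a::field triple" where
  "rmap_id = (monom3 1 1 0 0, monom3 1 0 1 0, monom3 1 0 0 1)"

definition rmap_comp :: "'a::field triple \<Rightarrow> 'a triple \<Rightarrow> 'a triple" where
  "rmap_comp = (\<lambda>(F\<^sub>0, F\<^sub>1, F\<^sub>2) G. (subst3 F\<^sub>0 G, subst3 F\<^sub>1 G, subst3 F\<^sub>2 G))"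

definition rmap_iterate :: "nat \<Rightarrow> 'a::field triple \<Rightarrow> 'a triple" where
  "rmap_iterate m F = (rmap_comp F ^^ m) rmap_id"

text \<open>
  The triple \<^term>\<open>rmap_iterate m F\<close> may acquire common factors; these are discarded by
  \<^const>\<open>rmap_degree\<close>.
\<close>

definition has_dynamical_degree :: "'a::field triple \<Rightarrow> real \<Rightarrow> bool" where
  "has_dynamical_degree F l \<longleftrightarrow>
     (\<lambda>m. root m (real (rmap_degree (rmap_iterate m F)))) \<longlonglongrightarrow> l"

section \<open>Homogenization of polynomial maps of the plane\<close>

text \<open>\<open>homogenize d p\<close> is \<open>Z\<^sup>d p(X/Z, Y/Z)\<close>, for \<open>d\<close> at least the total degree of \<open>p\<close>.\<close>

definition homogenize :: "nat \<Rightarrow> 'a::comm_ring_1 poly2 \<Rightarrow> 'a poly3" where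
  "homogenize d p =
     (\<Sum>j\<le>degree p. \<Sum>i\<le>degree (coeff p j). monom3 (coeff2 p i j) i j (d - (i + j)))"

definition homogenization :: "'a::field poly2 \<times> 'a poly2 \<Rightarrow> 'a triple" where
  "homogenization = (\<lambda>(f\<^sub>1, f\<^sub>2).
     let d = max (total_degree2 f\<^sub>1) (total_degree2 f\<^sub>2)
     in (homogenize d f\<^sub>1, homogenize d f\<^sub>2, monom3 1 0 0 d))"

section \<open>Folding maps\<close>

text \<open>
  The integer polynomials \<open>X\<^sub>n\<close> and \<open>Y\<^sub>n\<close> as expressions in elements \<open>x\<close>, \<open>y\<close> of an arbitrary
  commutative ring; the folding maps over \<open>K\<close> arise by taking \<open>x\<close>, \<open>y\<close> to be the two variables
  of \<open>K[x,y]\<close>.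
\<close>

fun A_X :: "'r::comm_ring_1 \<Rightarrow> 'r \<Rightarrow> nat \<Rightarrow> 'r" and A_Y :: "'r \<Rightarrow> 'r \<Rightarrow> nat \<Rightarrow> 'r" where
  "A_X x y 0 = 3"
| "A_X x y (Suc 0) = x"
| "A_X x y (Suc (Suc 0)) = x^2 - y^2 - 2*x"
| "A_X x y (Suc (Suc (Suc n))) =
     x * (A_X x y (Suc (Suc n)) - A_X x y (Suc n))
     - y * (A_Y x y (Suc (Suc n)) + A_Y x y (Suc n)) + A_X x y n"
| "A_Y x y 0 = 0"
| "A_Y x y (Suc 0) = y"
| "A_Y x y (Suc (Suc 0)) = 2*x*y + 2*y"
| "A_Y x y (Suc (Suc (Suc n))) =
     x * (A_Y x y (Suc (Suc n)) - A_Y x y (Suc n))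
     + y * (A_X x y (Suc (Suc n)) + A_X x y (Suc n)) + A_Y x y n"

fun B_X :: "'r::comm_ring_1 \<Rightarrow> 'r \<Rightarrow> nat \<Rightarrow> 'r" where
  "B_X x y 0 = 4"
| "B_X x y (Suc 0) = x"
| "B_X x y (Suc (Suc 0)) = x^2 - 2*y - 4"
| "B_X x y (Suc (Suc (Suc 0))) = x^3 - 3*x*y - 3*x"
| "B_X x y (Suc (Suc (Suc (Suc n)))) =
     x * (B_X x y (Suc (Suc (Suc n))) + B_X x y (Suc n))
     - (2 + y) * B_X x y (Suc (Suc n)) - B_X x y n"

fun B_Y :: "'r::comm_ring_1 \<Rightarrow> 'r \<Rightarrow> nat \<Rightarrow> 'r" where
  "B_Y x y 0 = 4"
| "B_Y x y (Suc 0) = y"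
| "B_Y x y (Suc (Suc 0)) = y^2 - 2*x^2 + 4*y + 4"
| "B_Y x y (Suc (Suc (Suc 0))) = y^3 - 3*x^2*y + 6*y^2 + 9*y"
| "B_Y x y (Suc (Suc (Suc (Suc n)))) =
     y * (B_Y x y (Suc (Suc (Suc n))) + B_Y x y (Suc n))
     - (x^2 - 2*y - 2) * B_Y x y (Suc (Suc n)) - B_Y x y n"

fun G_X :: "'r::comm_ring_1 \<Rightarrow> 'r \<Rightarrow> nat \<Rightarrow> 'r" where
  "G_X x y 0 = 6"
| "G_X x y (Suc 0) = x"
| "G_X x y (Suc (Suc 0)) = x^2 - 2*x - 2*y - 6"
| "G_X x y (Suc (Suc (Suc 0))) = x^3 - 3*x*y - 9*x - 6*y - 12"
| "G_X x y (Suc (Suc (Suc (Suc 0)))) =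
     x^4 - 4*x^2*y - 10*x^2 - 4*x*y + 2*y^2 - 8*x + 8*y + 6"
| "G_X x y (Suc (Suc (Suc (Suc (Suc 0))))) =
     x^5 - 5*x^3*y - 15*x^3 - 5*x^2*y + 5*x*y^2 - 10*x^2 + 35*x*y + 10*y^2 + 55*x + 50*y + 60"
| "G_X x y (Suc (Suc (Suc (Suc (Suc (Suc n)))))) =
     x * (G_X x y (Suc (Suc (Suc (Suc (Suc n))))) + G_X x y (Suc n))
     - (x + y + 3) * (G_X x y (Suc (Suc (Suc (Suc n)))) + G_X x y (Suc (Suc n)))
     + (x^2 - 2*y - 4) * G_X x y (Suc (Suc (Suc n))) - G_X x y n"

fun G_Y :: "'r::comm_ring_1 \<Rightarrow> 'r \<Rightarrow> nat \<Rightarrow> 'r" where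
  "G_Y x y 0 = 6"
| "G_Y x y (Suc 0) = y"
| "G_Y x y (Suc (Suc 0)) = - 2*x^3 + 6*x*y + y^2 + 18*x + 10*y + 18"
| "G_Y x y (Suc (Suc (Suc 0))) =
     - 3*x^3*y - 6*x^3 + 9*x*y^2 + y^3 + 45*x*y + 18*y^2 + 54*x + 63*y + 60"
| "G_Y x y (Suc (Suc (Suc (Suc 0)))) =
     2*x^6 - 12*x^4*y - 4*x^3*y^2 - 36*x^4 - 28*x^3*y + 18*x^2*y^2 + 12*x*y^3 + y^4 - 40*x^3
     + 108*x^2*y + 120*x*y^2 + 24*y^3 + 162*x^2 + 372*x*y + 134*y^2 + 360*x + 280*y + 198"
| "G_Y x y (Suc (Suc (Suc (Suc (Suc 0))))) =
     5*x^6*y + 10*x^6 - 30*x^4*y^2 - 5*x^3*y^3 - 150*x^4*y - 65*x^3*y^2 + 45*x^2*y^3 + 15*x*y^4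
     + y^5 - 180*x^4 - 205*x^3*y + 360*x^2*y^2 + 240*x*y^3 + 30*y^4 - 190*x^3 + 945*x^2*y
     + 1200*x*y^2 + 255*y^3 + 810*x^2 + 2415*x*y + 920*y^2 + 1710*x + 1495*y + 900"
| "G_Y x y (Suc (Suc (Suc (Suc (Suc (Suc n)))))) =
     y * (G_Y x y (Suc (Suc (Suc (Suc (Suc n))))) + G_Y x y (Suc n))
     - (x^3 - 3*x*y - 9*x - 5*y - 9) * (G_Y x y (Suc (Suc (Suc (Suc n)))) + G_Y x y (Suc (Suc n)))
     + (y^2 - 2*x^3 + 6*x*y + 18*x + 12*y + 20) * G_Y x y (Suc (Suc (Suc n))) - G_Y x y n"

definition folding_A :: "nat \<Rightarrow> 'a::field poly2 \<times> 'a poly2" where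
  "folding_A n = (A_X var_x var_y n, A_Y var_x var_y n)"

definition folding_B :: "nat \<Rightarrow> 'a::field poly2 \<times> 'a poly2" where
  "folding_B n = (B_X var_x var_y n, B_Y var_x var_y n)"

definition folding_G :: "nat \<Rightarrow> 'a::field poly2 \<times> 'a poly2" where
  "folding_G n = (G_X var_x var_y n, G_Y var_x var_y n)"

end

(*
  If p, q have degree at most d and their degree-d parts are not both zero, then the triple
  (P, Q, Z^d) of the homogenizations has no common factor, and since Z is prime every other triple
  for the same map is a multiple of it. So degree, regularity and indeterminacy are all read off the degree-d parts on
  the line Z = 0, and these satisfy the truncated recurrences. For A_n the two parts combine to
  (x + i y)^n and (x - i y)^n. For B_n the first is x^n and the second is y^n on x = 0. For G_n the
  degree of X_n is at most n, while Y_n has degree floor(3n/2) with leading form 2 (-x^3)^(n/2) for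
  n even and n (-x^3)^((n-1)/2) y for n odd.

  For the dynamical degree, every point of the plane is parametrized by u, v, w with u v w = 1 so
  that G_n becomes (u, v, w) |-> (u^n, v^n, w^n). Hence the m-th iterate of G_n is G_(n^m), of
  degree floor(3 n^m / 2).
*)

theory Submission
  imports Defs
begin

section \<open>Evaluation of polynomials in several variables\<close>

lemma poly_eq_0_infinite:
  fixes p :: "'b::idom poly"
  assumes "infinite S" and "\<And>z. z \<in> S \<Longrightarrow> poly p z = 0"
  shows "p = 0"
proof (rule ccontr)
  assume "p \<noteq> 0"
  then have "finite {z. poly p z = 0}" by (rule poly_roots_finite)
  then have "finite S" by (rule rev_finite_subset) (use assms(2) in auto)
  with assms(1) show False ..
qed

text \<open>The variables are removed one at a time, \<open>x\<close> first: a polynomial over a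
  domain with infinitely many roots is zero, and the constants of the field give infinitely many
  points of each coefficient ring. Points with \<open>z = 0\<close> are left out because evaluating
  a homogenization divides by \<open>z\<close>.\<close>

lemma poly3_eqI:
  fixes F G :: "'a::field_char_0 poly3"
  assumes "\<And>x y z. z \<noteq> 0 \<Longrightarrow> eval3 F (x, y, z) = eval3 G (x, y, z)"
  shows "F = G"
proof -
  have inf: "infinite (UNIV :: 'a set)" "infinite (- {0 :: 'a})"
    by (simp_all add: infinite_UNIV_char_0 Compl_eq_Diff_UNIV)
  define D where "D = F - G"
  have D: "poly (poly (poly D [:[:z:]:]) [:y:]) x = 0" if "z \<noteq> 0" for x y z
    using assms[OF that, of x y] by (simp add: D_def eval3_def)
  have D1: "poly (poly D [:[:z:]:]) [:y:] = 0" if "z \<noteq> 0" for y z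
    by (rule poly_eq_0_infinite[OF inf(1)]) (simp add: D that)
  have "infinite (range (\<lambda>y :: 'a. [:y:]))"
    using inf(1) by (subst finite_image_iff) (auto simp: inj_on_def)
  then have D2: "poly D [:[:z:]:] = 0" if "z \<noteq> 0" for z
    by (rule poly_eq_0_infinite) (use D1 that in auto)
  have "infinite ((\<lambda>z :: 'a. [:[:z:]:]) ` (- {0}))"
    using inf(2) by (subst finite_image_iff) (auto simp: inj_on_def)
  then have "D = 0"
    by (rule poly_eq_0_infinite) (use D2 in auto)
  then show ?thesis by (simp add: D_def)
qed

lemma eval3_add [simp]: "eval3 (F + G) P = eval3 F P + eval3 G P"
  and eval3_uminus [simp]: "eval3 (- F) P = - eval3 F P"
  and eval3_mult [simp]: "eval3 (F * G) P = eval3 F P * eval3 G P"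
  and eval3_power [simp]: "eval3 (F ^ n) P = eval3 F P ^ n"
  and eval3_sum [simp]: "eval3 (\<Sum>a\<in>A. f a) P = (\<Sum>a\<in>A. eval3 (f a) P)"
  by (simp_all add: eval3_def poly_sum split: prod.split)

lemma eval3_monom3 [simp]: "eval3 (monom3 a i j k) (x, y, z) = a * x ^ i * y ^ j * z ^ k"
  by (simp add: eval3_def monom3_def poly_monom)

text \<open>This is the shape of \<open>subst3\<close>, so that evaluating a substitution becomes a
  termwise comparison of sums.\<close>

lemma eval3_altdef:
  "eval3 F (x, y, z) = (\<Sum>k\<le>degree F. \<Sum>j\<le>degree (coeff F k). \<Sum>i\<le>degree (coeff (coeff F k) j).
     coeff3 F i j k * x ^ i * y ^ j * z ^ k)"
  by (simp add: eval3_def poly_altdef[of F] poly_sum poly_altdef[of "coeff F _"]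
      poly_altdef[of "coeff (coeff F _) _"] coeff3_def sum_distrib_right)

lemma eval3_subst3:
  "eval3 (subst3 F (G\<^sub>0, G\<^sub>1, G\<^sub>2)) P = eval3 F (eval3 G\<^sub>0 P, eval3 G\<^sub>1 P, eval3 G\<^sub>2 P)"
  by (cases P) (simp add: subst3_def eval3_altdef[of F])

definition eval2 :: "'a::comm_ring_1 poly2 \<Rightarrow> 'a \<Rightarrow> 'a \<Rightarrow> 'a" where
  "eval2 p x y = poly (poly p [:y:]) x"

lemma eval2_add [simp]: "eval2 (p + q) x y = eval2 p x y + eval2 q x y"
  and eval2_diff [simp]: "eval2 (p - q) x y = eval2 p x y - eval2 q x y"
  and eval2_uminus [simp]: "eval2 (- p) x y = - eval2 p x y"
  and eval2_mult [simp]: "eval2 (p * q) x y = eval2 p x y * eval2 q x y"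
  and eval2_power [simp]: "eval2 (p ^ n) x y = eval2 p x y ^ n"
  and eval2_numeral [simp]: "eval2 (numeral k) x y = numeral k"
  and eval2_var_x [simp]: "eval2 var_x x y = x"
  and eval2_var_y [simp]: "eval2 var_y x y = y"
  by (simp_all add: eval2_def var_x_def var_y_def)

lemma eval2_altdef:
  "eval2 p x y = (\<Sum>j\<le>degree p. \<Sum>i\<le>degree (coeff p j). coeff2 p i j * x ^ i * y ^ j)"
  by (simp add: eval2_def poly_altdef[of p] poly_sum poly_altdef[of "coeff p _"]
      coeff2_def sum_distrib_right)

section \<open>Total degree and homogenization\<close>

text \<open>Makes the \<open>Max\<close> in \<open>total_degree2\<close> meaningful: the exponents
  of nonzero coefficients lie in a finite region given by the one-variable degrees.\<close>

lemma finite_exponent_sums: "finite {i + j | i j. coeff2 p i j \<noteq> 0}"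
proof -
  have "{i + j | i j. coeff2 p i j \<noteq> 0} \<subseteq>
      (\<lambda>(i, j). i + j) ` (SIGMA j:{..degree p}. {..degree (coeff p j)})"
  proof clarify
    fix i j assume "coeff2 p i j \<noteq> 0"
    then have "i \<le> degree (coeff p j)" "j \<le> degree p"
      by (auto simp: coeff2_def intro: le_degree)
    then show "i + j \<in> (\<lambda>(i, j). i + j) ` (SIGMA j:{..degree p}. {..degree (coeff p j)})"
      by (intro image_eqI[of _ _ "(j, i)"]) auto
  qed
  then show ?thesis by (rule finite_subset) auto
qed

lemma total_degree2_le_iff:
  "total_degree2 p \<le> d \<longleftrightarrow> (\<forall>i j. coeff2 p i j \<noteq> 0 \<longrightarrow> i + j \<le> d)"
  unfolding total_degree2_def by (subst Max_le_iff) (auto simp: finite_exponent_sums)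

lemma total_degree2_add_le:
  assumes "total_degree2 p \<le> d" "total_degree2 q \<le> d"
  shows "total_degree2 (p + q) \<le> d"
  unfolding total_degree2_le_iff
proof (intro allI impI)
  fix i j assume "coeff2 (p + q) i j \<noteq> 0"
  then have "coeff2 p i j \<noteq> 0 \<or> coeff2 q i j \<noteq> 0" by (auto simp: coeff2_def)
  then show "i + j \<le> d" using assms by (auto simp: total_degree2_le_iff)
qed

lemma total_degree2_uminus [simp]: "total_degree2 (- p) = total_degree2 (p :: 'a::ab_group_add poly2)"
  by (simp add: total_degree2_def coeff2_def)

text \<open>A nonzero coefficient of the product has a nonzero term in its double convolution, and
  the exponents of that term add up.\<close>

lemma total_degree2_mult_le:
  fixes p q :: "'a::comm_semiring_0 poly2"
  assumes "total_degree2 p \<le> d" "total_degree2 q \<le> e"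
  shows "total_degree2 (p * q) \<le> d + e"
  unfolding total_degree2_le_iff
proof (intro allI impI)
  fix i j assume "coeff2 (p * q) i j \<noteq> 0"
  then have "(\<Sum>j'\<le>j. \<Sum>i'\<le>i. coeff2 p i' j' * coeff2 q (i - i') (j - j')) \<noteq> 0"
    by (simp add: coeff2_def coeff_mult coeff_sum)
  then obtain i' j' where le: "j' \<le> j" "i' \<le> i"
    and "coeff2 p i' j' * coeff2 q (i - i') (j - j') \<noteq> 0"
    by (meson atMost_iff sum.not_neutral_contains_not_neutral)
  then have "coeff2 p i' j' \<noteq> 0" "coeff2 q (i - i') (j - j') \<noteq> 0" by auto
  then have "i' + j' \<le> d" "(i - i') + (j - j') \<le> e"
    using assms by (auto simp: total_degree2_le_iff)
  then show "i + j \<le> d + e" using le by linarith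
qed

text \<open>Termwise: where the coefficient is nonzero, \<open>i + j \<le> d\<close>, so the
  truncated subtraction \<open>d - (i + j)\<close> is a genuine one. Identities between
  homogenizations then reduce to identities of values at \<open>z \<noteq> 0\<close>.\<close>

lemma eval3_homogenize:
  fixes p :: "'a::field poly2"
  assumes "total_degree2 p \<le> d" "z \<noteq> 0"
  shows "eval3 (homogenize d p) (x, y, z) = z ^ d * eval2 p (x / z) (y / z)"
  unfolding homogenize_def eval2_altdef eval3_sum sum_distrib_left eval3_monom3
proof (intro sum.cong refl)
  fix i j
  show "coeff2 p i j * x ^ i * y ^ j * z ^ (d - (i + j)) =
      z ^ d * (coeff2 p i j * (x / z) ^ i * (y / z) ^ j)"
  proof (cases "coeff2 p i j = 0")
    case False
    then have "i + j \<le> d" using assms(1) by (simp add: total_degree2_le_iff)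
    then show ?thesis
      using assms(2) by (simp add: power_diff power_add power_divide)
  qed simp
qed

lemma homogenize_add:
  fixes p q :: "'a::field_char_0 poly2"
  assumes "total_degree2 p \<le> d" "total_degree2 q \<le> d"
  shows "homogenize d (p + q) = homogenize d p + homogenize d q"
  by (rule poly3_eqI) (simp add: assms eval3_homogenize total_degree2_add_le algebra_simps)

lemma homogenize_uminus: "homogenize d (- p) = - homogenize d (p :: 'a::field_char_0 poly2)"
  by (simp add: homogenize_def coeff2_def monom3_def sum_negf flip: minus_monom)

lemma homogenize_mult:
  fixes p q :: "'a::field_char_0 poly2"
  assumes "total_degree2 p \<le> d" "total_degree2 q \<le> e"
  shows "homogenize (d + e) (p * q) = homogenize d p * homogenize e q"
  by (rule poly3_eqI) (simp add: assms eval3_homogenize total_degree2_mult_le power_add)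

text \<open>Homogenizing in too large a degree produces a power of \<open>Z\<close>, hence zero on
  the line \<open>Z = 0\<close>.\<close>

lemma homogenize_raise:
  fixes p :: "'a::field_char_0 poly2"
  assumes "total_degree2 p \<le> d" "d \<le> D"
  shows "homogenize D p = monom3 1 0 0 (D - d) * homogenize d p"
proof (rule poly3_eqI)
  fix x y z :: 'a assume "z \<noteq> 0"
  then show "eval3 (homogenize D p) (x, y, z) =
      eval3 (monom3 1 0 0 (D - d) * homogenize d p) (x, y, z)"
    using assms by (simp add: eval3_homogenize power_diff)
qed

lemma coeff3_sum: "coeff3 (\<Sum>a\<in>A. f a) i j k = (\<Sum>a\<in>A. coeff3 (f a) i j k)"
  by (simp add: coeff3_def coeff_sum)

lemma coeff3_monom3: "coeff3 (monom3 a i j k) i' j' k' = (if i = i' \<and> j = j' \<and> k = k' then a else 0)"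
  by (simp add: coeff3_def monom3_def)

lemma homogeneous3_monom3: "i + j + k = d \<Longrightarrow> homogeneous3 d (monom3 a i j k)"
  by (auto simp: homogeneous3_def coeff3_monom3)

lemma homogeneous3_homogenize:
  assumes "total_degree2 p \<le> d"
  shows "homogeneous3 d (homogenize d p)"
  unfolding homogeneous3_def
proof (intro allI impI)
  fix i j k assume "coeff3 (homogenize d p) i j k \<noteq> 0"
  then obtain i' j' where nz: "coeff3 (monom3 (coeff2 p i' j') i' j' (d - (i' + j'))) i j k \<noteq> 0"
    unfolding homogenize_def coeff3_sum by (meson sum.not_neutral_contains_not_neutral)
  then have "coeff2 p i' j' \<noteq> 0" "i = i'" "j = j'" "k = d - (i' + j')"
    by (auto simp: coeff3_monom3 split: if_splits)
  moreover have "i' + j' \<le> d"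
    using \<open>coeff2 p i' j' \<noteq> 0\<close> assms by (simp add: total_degree2_le_iff)
  ultimately show "i + j + k = d" by simp
qed

text \<open>At \<open>Z = 0\<close> only monomials whose \<open>Z\<close>-exponent
  \<open>d - (i + j)\<close> is 0 survive, that is, those with \<open>i + j \<ge> d\<close>.\<close>

lemma total_degree2_ge:
  assumes "eval3 (homogenize d p) (x, y, 0) \<noteq> 0"
  shows "d \<le> total_degree2 p"
proof -
  from assms obtain i j where "coeff2 p i j * x ^ i * y ^ j * 0 ^ (d - (i + j)) \<noteq> 0"
    unfolding homogenize_def eval3_sum eval3_monom3
    by (meson sum.not_neutral_contains_not_neutral)
  then have "coeff2 p i j \<noteq> 0" "d \<le> i + j" by (auto simp: power_0_left split: if_splits)
  moreover from this(1) have "i + j \<le> total_degree2 p"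
    using total_degree2_le_iff by blast
  ultimately show ?thesis by simp
qed

text \<open>
  \<open>c\<close> is the value at \<open>(x, y)\<close> of the part of \<open>p\<close> of degree \<open>d\<close>, and there is no part of larger
  degree. In particular \<open>d\<close> is only an upper bound for the degree, and \<open>c = 0\<close> is allowed.
\<close>

definition top_value :: "'a::field_char_0 \<Rightarrow> 'a \<Rightarrow> nat \<Rightarrow> 'a poly2 \<Rightarrow> 'a \<Rightarrow> bool" where
  "top_value x y d p c \<longleftrightarrow> total_degree2 p \<le> d \<and> eval3 (homogenize d p) (x, y, 0) = c"

lemma top_value_raise:
  assumes "top_value x y e p c" "e \<le> d"
  shows "top_value x y d p (if d \<le> e then c else 0)"
  using assms by (auto simp: top_value_def homogenize_raise[of p e d])

lemma top_value_uminus: "top_value x y d p c \<Longrightarrow> top_value x y d (- p) (- c)"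
  by (simp add: top_value_def homogenize_uminus)

text \<open>\<open>max d e\<close> and the two conditionals keep the rule free of side conditions,
  so that it applies by unification alone. A summand with the smaller degree bound contributes
  nothing.\<close>

lemma top_value_add:
  assumes "top_value x y d p a" "top_value x y e q b"
  shows "top_value x y (max d e) (p + q) ((if e \<le> d then a else 0) + (if d \<le> e then b else 0))"
proof -
  have "top_value x y (max d e) p (if e \<le> d then a else 0)"
    "top_value x y (max d e) q (if d \<le> e then b else 0)"
    using top_value_raise[OF assms(1), of "max d e"] top_value_raise[OF assms(2), of "max d e"]
    by simp_all
  then show ?thesis
    unfolding top_value_def by (simp only: homogenize_add total_degree2_add_le eval3_add simp_thms)
qed

lemma top_value_diff:
  assumes "top_value x y d p a" "top_value x y e q b"
  shows "top_value x y (max d e) (p - q) ((if e \<le> d then a else 0) - (if d \<le> e then b else 0))"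
proof -
  have "top_value x y (max d e) (p + - q) ((if e \<le> d then a else 0) + (if d \<le> e then - b else 0))"
    by (rule top_value_add[OF assms(1) top_value_uminus[OF assms(2)]])
  moreover have "(if e \<le> d then a else 0) + (if d \<le> e then - b else 0) =
      (if e \<le> d then a else 0) - (if d \<le> e then b else 0)"
    by simp
  ultimately show ?thesis by (simp only: add_uminus_conv_diff)
qed

lemma top_value_mult:
  assumes "top_value x y d p a" "top_value x y e q b"
  shows "top_value x y (d + e) (p * q) (a * b)"
  using assms by (simp add: top_value_def homogenize_mult total_degree2_mult_le)

lemma top_value_numeral: "top_value x y 0 (numeral k) (numeral k)"
  and top_value_0: "top_value x y 0 0 0"
  and top_value_1: "top_value x y 0 1 1"
  and top_value_var_x: "top_value x y 1 var_x x"
  and top_value_var_y: "top_value x y 1 var_y y"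
  using total_degree2_le_iff[of "numeral k :: 'a poly2" 0] total_degree2_le_iff[of "0 :: 'a poly2" 0]
    total_degree2_le_iff[of "1 :: 'a poly2" 0]
  by (simp_all add: top_value_def total_degree2_le_iff homogenize_def coeff2_def var_x_def var_y_def
      numeral_poly one_pCons coeff_pCons split: nat.splits)

lemma top_value_power: "top_value x y d p a \<Longrightarrow> top_value x y (d * n) (p ^ n) (a ^ n)"
proof (induction n)
  case 0 then show ?case by (simp add: top_value_1)
next
  case (Suc n)
  then show ?case using top_value_mult[OF Suc.prems Suc.IH[OF Suc.prems]] by simp
qed

lemmas top_value_rules =
  top_value_add top_value_diff top_value_mult top_value_power top_value_uminus
  top_value_numeral top_value_0 top_value_1 top_value_var_x top_value_var_y

text \<open>The rules above compute a degree bound and a value from the syntax of \<open>p\<close>.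
  This rule leaves both open during that computation and compares them with the intended ones
  afterwards.\<close>

lemma top_value_cong: "top_value x y e p b \<Longrightarrow> e = d \<Longrightarrow> b = c \<Longrightarrow> top_value x y d p c"
  by simp

section \<open>Homogenized polynomial maps as rational maps\<close>

lemma monom3_Z: "monom3 1 0 0 d = ([:0, 1:] :: 'a::field poly3) ^ d"
proof -
  have "monom3 (1 :: 'a) 0 0 d = monom 1 d"
    by (simp add: monom3_def monom_0 one_pCons)
  also have "\<dots> = monom 1 1 ^ d" by (simp add: monom_power)
  finally show ?thesis by (simp add: monom_altdef)
qed

lemma monom3_mult: "monom3 a i j k * monom3 b i' j' k' = monom3 (a * b) (i + i') (j + j') (k + k')"
  by (simp add: monom3_def mult_monom)

text \<open>One factor \<open>c\<close> is split off at a time: it divides \<open>a * b\<close> but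
  not \<open>a\<close>, hence divides \<open>b\<close>, and is cancelled.\<close>

lemma prime_elem_power_dvd_multD:
  fixes c :: "'b::idom"
  assumes "prime_elem c" "\<not> c dvd a" "c ^ d dvd a * b"
  shows "c ^ d dvd b"
  using assms(3)
proof (induction d arbitrary: b)
  case (Suc d)
  have "c dvd a * b" using Suc.prems by (metis dvd_mult_left power_Suc)
  then have "c dvd b" using assms(1,2) by (simp add: prime_elem_dvd_mult_iff)
  then obtain b' where b': "b = c * b'" by (elim dvdE)
  have "c * c ^ d dvd c * (a * b')" using Suc.prems by (simp add: b' mult.left_commute)
  then have "c ^ d dvd a * b'" using assms(1) by (simp add: prime_elem_def)
  from Suc.IH[OF this] show ?case by (simp add: b' mult_dvd_mono)
qed simp

lemma prime_elem_Z: "prime_elem ([:0, 1:] :: 'a::idom poly)"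
  by (auto simp: prime_elem_def dvd_iff_poly_eq_0 is_unit_poly_iff simp del: mult_pCons_left)

lemmas Z_power_dvd_mult_cancel = prime_elem_power_dvd_multD[OF prime_elem_Z]

text \<open>In contrast to \<open>homogenization\<close>, the degree is a parameter and may exceed
  the true one. Composing triples without cancelling leads to such non-reduced triples.\<close>

definition hom_triple :: "nat \<Rightarrow> 'a::field poly2 \<times> 'a poly2 \<Rightarrow> 'a triple" where
  "hom_triple d = (\<lambda>(p, q). (homogenize d p, homogenize d q, monom3 1 0 0 d))"

text \<open>Expresses that the larger of the two degrees is \<open>d\<close> through a point at
  infinity where one of the degree-\<open>d\<close> parts is nonzero. Such a point is what
  \<open>top_value\<close> provides, and it excludes divisibility of both components by
  \<open>Z\<close>.\<close>

definition exact_degree :: "nat \<Rightarrow> 'a::field poly2 \<times> 'a poly2 \<Rightarrow> bool" where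
  "exact_degree d = (\<lambda>(p, q). total_degree2 p \<le> d \<and> total_degree2 q \<le> d \<and>
     (\<exists>x y. eval3 (homogenize d p) (x, y, 0) \<noteq> 0 \<or> eval3 (homogenize d q) (x, y, 0) \<noteq> 0))"

lemma homogenization_eq_hom_triple:
  assumes "exact_degree d f"
  shows "homogenization f = hom_triple d f"
proof -
  obtain p q where f: "f = (p, q)" by (cases f)
  have "d \<le> max (total_degree2 p) (total_degree2 q)"
    using assms by (auto simp: exact_degree_def f le_max_iff_disj dest!: total_degree2_ge)
  then have "max (total_degree2 p) (total_degree2 q) = d"
    using assms by (auto simp: exact_degree_def f)
  then show ?thesis by (simp add: homogenization_def hom_triple_def f)
qed

lemma homogeneous_triple_hom_triple:
  fixes p q :: "'a::field poly2"
  assumes "total_degree2 p \<le> d" "total_degree2 q \<le> d"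
  shows "homogeneous_triple d (hom_triple d (p, q))"
proof -
  have "monom3 1 0 0 d \<noteq> (0 :: 'a poly3)" by (simp add: monom3_def)
  then show ?thesis
    using assms
    by (simp add: homogeneous_triple_def hom_triple_def homogeneous3_homogenize homogeneous3_monom3)
qed

definition triple_scale :: "'a::field poly3 \<Rightarrow> 'a triple \<Rightarrow> 'a triple" where
  "triple_scale H = (\<lambda>(F\<^sub>0, F\<^sub>1, F\<^sub>2). (H * F\<^sub>0, H * F\<^sub>1, H * F\<^sub>2))"

lemma exact_degree_not_Z_dvd:
  assumes "exact_degree d (p, q)"
  shows "\<not> [:0, 1:] dvd homogenize d p \<or> \<not> [:0, 1:] dvd homogenize d q"
  using assms by (auto simp: exact_degree_def eval3_def dvd_iff_poly_eq_0)

text \<open>A common factor \<open>h\<close> is not divisible by \<open>Z\<close>, yet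
  \<open>h * k = Z^d\<close> for some \<open>k\<close>. Since \<open>Z\<close> is prime,
  \<open>Z^d\<close> divides \<open>k\<close>, and cancelling it makes \<open>h\<close> a
  unit.\<close>

lemma no_common_factor_hom_triple:
  assumes "exact_degree d f"
  shows "no_common_factor (hom_triple d f)"
proof -
  obtain p q where f: "f = (p, q)" by (cases f)
  show ?thesis
    unfolding no_common_factor_def hom_triple_def f prod.case
  proof (intro allI impI)
    fix h :: "'a poly3"
    assume h: "h dvd homogenize d p \<and> h dvd homogenize d q \<and> h dvd monom3 1 0 0 d"
    then have "\<not> [:0, 1:] dvd h"
      using exact_degree_not_Z_dvd[OF assms[unfolded f]] by (meson dvd_trans)
    moreover obtain k where k: "[:0, 1:] ^ d = h * k"
      using h unfolding monom3_Z by (auto elim: dvdE)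
    ultimately have "[:0, 1:] ^ d dvd k"
      using Z_power_dvd_mult_cancel[of h d k] by (metis dvd_refl)
    then obtain k' where "k = [:0, 1:] ^ d * k'" by (elim dvdE)
    then have "[:0, 1:] ^ d * (h * k') = [:0, 1:] ^ d * 1"
      using k by (simp add: mult.left_commute)
    then have "h * k' = 1" by (subst (asm) mult_cancel_left) simp
    then show "is_unit h" by (metis dvd_triv_left)
  qed
qed

lemma hom_triple_raise:
  fixes f :: "'a::field_char_0 poly2 \<times> 'a poly2"
  assumes "exact_degree d f" "d \<le> D"
  shows "hom_triple D f = triple_scale (monom3 1 0 0 (D - d)) (hom_triple d f)"
  using assms
  by (auto simp: hom_triple_def triple_scale_def exact_degree_def homogenize_raise[of _ d D] monom3_mult)

lemma rational_map_hom_triple: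
  assumes "exact_degree d f" "d \<le> D"
  shows "rational_map (hom_triple D f)"
  using assms homogeneous_triple_hom_triple[of "fst f" D "snd f"]
  by (auto simp: rational_map_def exact_degree_def)

lemma same_map_hom_triple:
  fixes f :: "'a::field_char_0 poly2 \<times> 'a poly2"
  assumes "exact_degree d f" "d \<le> D"
  shows "same_map (hom_triple D f) (hom_triple d f)"
proof -
  obtain F\<^sub>0 F\<^sub>1 F\<^sub>2 where F: "hom_triple d f = (F\<^sub>0, F\<^sub>1, F\<^sub>2)" by (metis prod_cases3)
  show ?thesis
    using rational_map_hom_triple[OF assms] rational_map_hom_triple[OF assms(1) order_refl]
    by (simp add: hom_triple_raise[OF assms] F triple_scale_def same_map_def mult_ac)
qed

text \<open>
  Since \<open>Z\<close> is prime and does not divide both of the first two components, \<open>Z\<^sup>d\<close> divides the third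
  component of every triple representing the same map.
\<close>

lemma same_map_hom_tripleD:
  fixes f :: "'a::field_char_0 poly2 \<times> 'a poly2"
  assumes f: "exact_degree d f" "d \<le> D" and G: "same_map (hom_triple D f) G"
  obtains H where "G = triple_scale H (hom_triple d f)"
proof -
  obtain p q where pq: "f = (p, q)" by (cases f)
  obtain G\<^sub>0 G\<^sub>1 G\<^sub>2 where G_eq: "G = (G\<^sub>0, G\<^sub>1, G\<^sub>2)" by (metis prod_cases3)
  define F\<^sub>0 F\<^sub>1 where "F\<^sub>0 = homogenize d p" and "F\<^sub>1 = homogenize d q"
  let ?Z = "[:0, 1:] :: 'a poly3"
  have Z: "?Z ^ n \<noteq> 0" for n by simp
  \<comment> \<open>These are the two minors involving the third component, which is a power of
    \<open>Z\<close> for the homogenized map.\<close>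
  have "?Z ^ (D - d) * (F\<^sub>0 * G\<^sub>2) = ?Z ^ (D - d) * (?Z ^ d * G\<^sub>0)"
    "?Z ^ (D - d) * (F\<^sub>1 * G\<^sub>2) = ?Z ^ (D - d) * (?Z ^ d * G\<^sub>1)"
    using G unfolding hom_triple_raise[OF f]
    by (simp_all add: G_eq pq hom_triple_def triple_scale_def same_map_def F\<^sub>0_def F\<^sub>1_def monom3_Z
        mult.assoc del: mult_pCons_left)
  then have eq: "F\<^sub>0 * G\<^sub>2 = ?Z ^ d * G\<^sub>0" "F\<^sub>1 * G\<^sub>2 = ?Z ^ d * G\<^sub>1"
    using Z[of "D - d"] by (simp_all only: mult_cancel_left simp_thms)
  then have "?Z ^ d dvd G\<^sub>2"
    using exact_degree_not_Z_dvd[OF f(1)[unfolded pq]] Z_power_dvd_mult_cancel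
    unfolding F\<^sub>0_def[symmetric] F\<^sub>1_def[symmetric] by (metis dvd_triv_left)
  then obtain H where H: "G\<^sub>2 = ?Z ^ d * H" by (elim dvdE)
  have "?Z ^ d * G\<^sub>0 = ?Z ^ d * (H * F\<^sub>0)" "?Z ^ d * G\<^sub>1 = ?Z ^ d * (H * F\<^sub>1)"
    unfolding eq[symmetric] H by (simp_all only: mult_ac)
  then have "G\<^sub>0 = H * F\<^sub>0" "G\<^sub>1 = H * F\<^sub>1"
    using Z[of d] by (simp_all only: mult_cancel_left simp_thms)
  then have "G = triple_scale H (hom_triple d f)"
    by (simp add: G_eq H pq hom_triple_def triple_scale_def F\<^sub>0_def F\<^sub>1_def monom3_Z mult.commute)
  then show thesis by (rule that)
qed

text \<open>The multiplier \<open>H\<close> divides all three components of \<open>G\<close>, so it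
  is a unit, that is, a nonzero constant.\<close>

lemma same_map_hom_triple_no_common_factorD:
  fixes f :: "'a::field_char_0 poly2 \<times> 'a poly2"
  assumes "exact_degree d f" "d \<le> D" "same_map (hom_triple D f) G" "no_common_factor G"
  obtains c where "c \<noteq> 0" "G = triple_scale (monom3 c 0 0 0) (hom_triple d f)"
proof -
  obtain H where H: "G = triple_scale H (hom_triple d f)"
    using same_map_hom_tripleD[OF assms(1-3)] .
  have "is_unit H"
    using assms(4) by (auto simp: H triple_scale_def no_common_factor_def split: prod.splits)
  then obtain c where "H = [:[:[:c:]:]:]" "c dvd 1"
    by (metis is_unit_poly_iff)
  then show thesis
    using H by (intro that[of c]) (auto simp: monom3_def monom_0)
qed

lemma rmap_degree_hom_triple:
  fixes f :: "'a::field_char_0 poly2 \<times> 'a poly2"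
  assumes "exact_degree d f" "d \<le> D"
  shows "rmap_degree (hom_triple D f) = d"
proof -
  obtain p q where pq: "f = (p, q)" by (cases f)
  show ?thesis
    unfolding rmap_degree_def
  proof (rule the_equality)
    have "homogeneous_triple d (hom_triple d f)"
      using assms(1) unfolding pq by (intro homogeneous_triple_hom_triple) (auto simp: exact_degree_def)
    then show "\<exists>G. same_map (hom_triple D f) G \<and> no_common_factor G \<and> homogeneous_triple d G"
      using same_map_hom_triple[OF assms] no_common_factor_hom_triple[OF assms(1)] by blast
  next
    fix e
    assume "\<exists>G. same_map (hom_triple D f) G \<and> no_common_factor G \<and> homogeneous_triple e G"
    then obtain G where G: "same_map (hom_triple D f) G" "no_common_factor G" "homogeneous_triple e G"
      by blast
    obtain c where c: "c \<noteq> 0" "G = triple_scale (monom3 c 0 0 0) (hom_triple d f)"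
      using same_map_hom_triple_no_common_factorD[OF assms G(1,2)] .
    \<comment> \<open>The third component is the nonzero monomial \<open>c Z^d\<close>, which is
      homogeneous in degree \<open>d\<close> only.\<close>
    have "homogeneous3 e (monom3 c 0 0 d)"
      using G(3)
      by (simp add: c(2) pq triple_scale_def hom_triple_def homogeneous_triple_def monom3_mult)
    moreover have "coeff3 (monom3 c 0 0 d) 0 0 d \<noteq> 0" using c(1) by (simp add: coeff3_monom3)
    ultimately have "0 + 0 + d = e" unfolding homogeneous3_def by blast
    then show "e = d" by simp
  qed
qed

section \<open>Indeterminacy, regularity and zeros at infinity\<close>

lemma zero_locus_triple_scale: "zero_locus F \<subseteq> zero_locus (triple_scale H F)"
proof -
  obtain F\<^sub>0 F\<^sub>1 F\<^sub>2 where F: "F = (F\<^sub>0, F\<^sub>1, F\<^sub>2)" by (metis prod_cases3)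
  show ?thesis
    unfolding zero_locus_def triple_scale_def F prod.case eval3_mult by fastforce
qed

lemma zero_locus_scale_const:
  "c \<noteq> 0 \<Longrightarrow> zero_locus (triple_scale (monom3 c 0 0 0) F) = zero_locus F"
  by (cases F) (simp add: zero_locus_def triple_scale_def)

lemma indeterminacy_locus_hom_triple:
  fixes f :: "'a::field_char_0 poly2 \<times> 'a poly2"
  assumes "exact_degree d f"
  shows "indeterminacy_locus (hom_triple d f) = zero_locus (hom_triple d f)"
proof (intro equalityI subsetI)
  fix P assume "P \<in> indeterminacy_locus (hom_triple d f)"
  then obtain G where G: "same_map (hom_triple d f) G" "no_common_factor G" "P \<in> zero_locus G"
    by (auto simp: indeterminacy_locus_def)
  from same_map_hom_triple_no_common_factorD[OF assms order_refl G(1,2)]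
  show "P \<in> zero_locus (hom_triple d f)"
    using G(3) by (metis zero_locus_scale_const)
next
  fix P assume "P \<in> zero_locus (hom_triple d f)"
  then show "P \<in> indeterminacy_locus (hom_triple d f)"
    unfolding indeterminacy_locus_def
    using same_map_hom_triple[OF assms order_refl] no_common_factor_hom_triple[OF assms] by blast
qed

text \<open>Every representative is a multiple of \<open>hom_triple d f\<close>, so none is nonzero
  at a common zero of that triple.\<close>

lemma regular_at_hom_triple_iff:
  fixes f :: "'a::field_char_0 poly2 \<times> 'a poly2"
  assumes "exact_degree d f"
  shows "regular_at (hom_triple d f) P \<longleftrightarrow> P \<notin> zero_locus (hom_triple d f)"
proof
  assume "regular_at (hom_triple d f) P"
  then obtain G where G: "same_map (hom_triple d f) G" "P \<notin> zero_locus G"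
    by (auto simp: regular_at_def)
  obtain H where "G = triple_scale H (hom_triple d f)"
    using same_map_hom_tripleD[OF assms order_refl G(1)] .
  then show "P \<notin> zero_locus (hom_triple d f)" using G(2) zero_locus_triple_scale by blast
next
  assume "P \<notin> zero_locus (hom_triple d f)"
  then show "regular_at (hom_triple d f) P"
    unfolding regular_at_def using same_map_hom_triple[OF assms order_refl] by blast
qed

lemma is_morphism_hom_triple_iff:
  fixes f :: "'a::field_char_0 poly2 \<times> 'a poly2"
  assumes "exact_degree d f"
  shows "is_morphism (hom_triple d f) \<longleftrightarrow> zero_locus (hom_triple d f) = {}"
  using rational_map_hom_triple[OF assms order_refl]
  by (auto simp: is_morphism_def regular_at_hom_triple_iff[OF assms])

lemma zero_locus_hom_triple:
  assumes "d \<ge> 1"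
  shows "zero_locus (hom_triple d (p, q)) = {proj_point x y 0 | x y. (x, y) \<noteq> (0, 0) \<and>
    eval3 (homogenize d p) (x, y, 0) = 0 \<and> eval3 (homogenize d q) (x, y, 0) = 0}"
  using assms by (auto simp: zero_locus_def hom_triple_def)

lemma proj_point_eqI:
  assumes "c \<noteq> 0" "(x, y, z) \<noteq> (0, 0, 0)"
  shows "proj_point (c * x) (c * y) (c * z) = proj_point x y z"
  unfolding proj_point_def
  by (rule Quotient3_rel_abs[OF Quotient3_proj_plane, symmetric])
    (use assms in \<open>auto simp: proj_rel_def\<close>)

text \<open>At \<open>z \<noteq> 0\<close> the inner triple is \<open>z^e\<close> times
  \<open>(p', q', 1)\<close> taken at \<open>(x/z, y/z)\<close>, so the outer one gives
  \<open>z^(d*e)\<close> times \<open>(p'', q'', 1)\<close>. The result carries the formal degree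
  \<open>d * e\<close>, with possible powers of \<open>Z\<close> uncancelled.\<close>

lemma rmap_comp_hom_triple:
  fixes p q p' q' p'' q'' :: "'a::field_char_0 poly2"
  assumes "total_degree2 p \<le> d" "total_degree2 q \<le> d"
    and "total_degree2 p' \<le> e" "total_degree2 q' \<le> e"
    and "total_degree2 p'' \<le> d * e" "total_degree2 q'' \<le> d * e"
    and "\<And>x y. eval2 p'' x y = eval2 p (eval2 p' x y) (eval2 q' x y)"
    and "\<And>x y. eval2 q'' x y = eval2 q (eval2 p' x y) (eval2 q' x y)"
  shows "rmap_comp (hom_triple d (p, q)) (hom_triple e (p', q')) = hom_triple (d * e) (p'', q'')"
  unfolding rmap_comp_def hom_triple_def prod.case prod.inject
  by (intro conjI; rule poly3_eqI;
      simp add: eval3_subst3 eval3_homogenize assms mult.commute flip: power_mult)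

section \<open>Leading forms of the folding maps\<close>

text \<open>In top degree the recurrence keeps only \<open>x X - y Y\<close> and
  \<open>x Y + y X\<close> of the preceding pair. This is multiplication of \<open>a + i b\<close>
  by \<open>x + i y\<close> and of \<open>a - i b\<close> by \<open>x - i y\<close>.\<close>

lemma top_value_A:
  fixes x y :: "'a::field_char_0"
  assumes i: "i ^ 2 = - 1"
  shows "n \<ge> 1 \<Longrightarrow> \<exists>a b. top_value x y n (A_X var_x var_y n) a \<and> top_value x y n (A_Y var_x var_y n) b \<and>
    a + i * b = (x + i * y) ^ n \<and> a - i * b = (x - i * y) ^ n"
proof (induction n rule: less_induct)
  have ii: "i * (i * t) = - t" for t
    using i by (simp add: power2_eq_square flip: mult.assoc)
  case (less n)
  consider "n = 1" | "n = 2" | m where "n = Suc (Suc (Suc m))"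
    using less.prems by (metis One_nat_def Suc_1 not0_implies_Suc not_one_le_zero)
  then show ?case
  proof cases
    case 1
    then show ?thesis using top_value_var_x top_value_var_y by fastforce
  next
    case 2
    have "top_value x y 2 (A_X var_x var_y 2) (x^2 - y^2)"
      unfolding numeral_2_eq_2 A_X.simps
      by (rule top_value_cong, (rule top_value_rules)+) simp_all
    moreover have "top_value x y 2 (A_Y var_x var_y 2) (2 * x * y)"
      unfolding numeral_2_eq_2 A_Y.simps
      by (rule top_value_cong, (rule top_value_rules)+) simp_all
    moreover have "(x^2 - y^2) + i * (2 * x * y) = (x + i * y) ^ 2"
      "(x^2 - y^2) - i * (2 * x * y) = (x - i * y) ^ 2"
      by (simp_all add: algebra_simps power2_eq_square ii)
    ultimately show ?thesis unfolding 2 by blast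
  next
    case 3
    obtain a b where ab: "top_value x y (Suc (Suc m)) (A_X var_x var_y (Suc (Suc m))) a"
      "top_value x y (Suc (Suc m)) (A_Y var_x var_y (Suc (Suc m))) b"
      "a + i * b = (x + i * y) ^ (Suc (Suc m))" "a - i * b = (x - i * y) ^ (Suc (Suc m))"
      using less.IH[of "Suc (Suc m)"] 3 by auto
    obtain a' b' where ab': "top_value x y (Suc m) (A_X var_x var_y (Suc m)) a'"
      "top_value x y (Suc m) (A_Y var_x var_y (Suc m)) b'"
      using less.IH[of "Suc m"] 3 by auto
    \<comment> \<open>The formula fails at index 0, where \<open>(3, 0)\<close> would have to give
      1. The term has too low a degree for its value to enter, so a degree bound suffices.\<close>
    obtain a'' b'' where ab'': "top_value x y m (A_X var_x var_y m) a''"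
      "top_value x y m (A_Y var_x var_y m) b''"
    proof (cases "m = 0")
      case True
      then show thesis using that[of 3 0] by (simp add: top_value_numeral top_value_0)
    next
      case False
      then show thesis using less.IH[of m] 3 that by auto
    qed
    have "top_value x y n (A_X var_x var_y n) (x * a - y * b)"
      unfolding 3 A_X.simps
      by (rule top_value_cong, (rule top_value_rules ab ab' ab'')+) simp_all
    moreover have "top_value x y n (A_Y var_x var_y n) (x * b + y * a)"
      unfolding 3 A_Y.simps
      by (rule top_value_cong, (rule top_value_rules ab ab' ab'')+) simp_all
    moreover have "(x * a - y * b) + i * (x * b + y * a) = (x + i * y) * (a + i * b)"
      "(x * a - y * b) - i * (x * b + y * a) = (x - i * y) * (a - i * b)"
      by (simp_all add: algebra_simps ii)
    ultimately show ?thesis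
      unfolding ab 3 power_Suc[symmetric] by blast
  qed
qed

text \<open>Only \<open>x * X_(n-1)\<close> reaches degree \<open>n\<close> in the
  recurrence.\<close>

lemma top_value_B_X:
  fixes x y :: "'a::field_char_0"
  shows "n \<ge> 1 \<Longrightarrow> top_value x y n (B_X var_x var_y n) (x ^ n)"
proof (induction n rule: less_induct)
  case (less n)
  consider "n = 1" | "n = Suc (Suc 0)" | "n = Suc (Suc (Suc 0))" | m where "n = Suc (Suc (Suc (Suc m)))"
    using less.prems by (metis One_nat_def not0_implies_Suc not_one_le_zero)
  then show ?case
  proof cases
    case 1
    then show ?thesis using top_value_var_x by simp
  next
    case 2
    show ?thesis unfolding 2 B_X.simps
      by (rule top_value_cong, (rule top_value_rules)+) (simp_all add: power2_eq_square)
  next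
    case 3
    show ?thesis unfolding 3 B_X.simps
      by (rule top_value_cong, (rule top_value_rules)+) (simp_all add: eval_nat_numeral)
  next
    case 4
    have IH: "top_value x y k (B_X var_x var_y k) (x ^ k)" if "k < n" "k \<ge> 1" for k
      using less.IH that by blast
    obtain c where c: "top_value x y m (B_X var_x var_y m) c"
    proof (cases "m = 0")
      case True
      then show thesis using that[of 4] by (simp add: top_value_numeral)
    next
      case False
      then show thesis using IH[of m] 4 that by auto
    qed
    have IHs: "top_value x y (Suc (Suc (Suc m))) (B_X var_x var_y (Suc (Suc (Suc m)))) (x ^ (Suc (Suc (Suc m))))"
      "top_value x y (Suc (Suc m)) (B_X var_x var_y (Suc (Suc m))) (x ^ (Suc (Suc m)))"
      "top_value x y (Suc m) (B_X var_x var_y (Suc m)) (x ^ (Suc m))"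
      by (rule IH; simp add: 4)+
    show ?thesis
      unfolding 4 B_X.simps
      by (rule top_value_cong, (rule top_value_rules IHs c)+) (simp_all add: 4)
  qed
qed

text \<open>The terms of top degree are \<open>y * Y_(n-1)\<close> and \<open>x^2 * Y_(n-2)\<close>.
  On \<open>x = 0\<close>, the zero set of the leading form of \<open>X_n\<close>, only the first
  one survives.\<close>

lemma top_value_B_Y:
  fixes y :: "'a::field_char_0"
  shows "n \<ge> 1 \<Longrightarrow> top_value 0 y n (B_Y var_x var_y n) (y ^ n)"
proof (induction n rule: less_induct)
  case (less n)
  consider "n = 1" | "n = Suc (Suc 0)" | "n = Suc (Suc (Suc 0))" | m where "n = Suc (Suc (Suc (Suc m)))"
    using less.prems by (metis One_nat_def not0_implies_Suc not_one_le_zero)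
  then show ?case
  proof cases
    case 1
    then show ?thesis using top_value_var_y by simp
  next
    case 2
    show ?thesis unfolding 2 B_Y.simps
      by (rule top_value_cong, (rule top_value_rules)+) (simp_all add: power2_eq_square)
  next
    case 3
    show ?thesis unfolding 3 B_Y.simps
      by (rule top_value_cong, (rule top_value_rules)+) (simp_all add: eval_nat_numeral)
  next
    case 4
    have IH: "top_value 0 y k (B_Y var_x var_y k) (y ^ k)" if "k < n" "k \<ge> 1" for k
      using less.IH that by blast
    obtain c where c: "top_value 0 y m (B_Y var_x var_y m) c"
    proof (cases "m = 0")
      case True
      then show thesis using that[of 4] by (simp add: top_value_numeral)
    next
      case False
      then show thesis using IH[of m] 4 that by auto
    qed
    have IHs: "top_value 0 y (Suc (Suc (Suc m))) (B_Y var_x var_y (Suc (Suc (Suc m)))) (y ^ (Suc (Suc (Suc m))))"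
      "top_value 0 y (Suc (Suc m)) (B_Y var_x var_y (Suc (Suc m))) (y ^ (Suc (Suc m)))"
      "top_value 0 y (Suc m) (B_Y var_x var_y (Suc m)) (y ^ (Suc m))"
      by (rule IH; simp add: 4)+
    show ?thesis
      unfolding 4 B_Y.simps
      by (rule top_value_cong, (rule top_value_rules IHs c)+) (simp_all add: 4)
  qed
qed

text \<open>Serves to bound the degree of \<open>X_n\<close> by \<open>n\<close>, hence the value is
  left existential.\<close>

lemma top_value_G_X:
  fixes x y :: "'a::field_char_0"
  shows "\<exists>c. top_value x y n (G_X var_x var_y n) c"
proof (induction n rule: less_induct)
  case (less n)
  consider "n = 0" | "n = Suc 0" | "n = Suc (Suc 0)" | "n = Suc (Suc (Suc 0))"
    | "n = Suc (Suc (Suc (Suc 0)))" | "n = Suc (Suc (Suc (Suc (Suc 0))))"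
    | m where "n = Suc (Suc (Suc (Suc (Suc (Suc m)))))"
    by (metis not0_implies_Suc)
  then show ?case
  proof cases
    case 7
    from less.IH obtain c where "\<And>k. k < n \<Longrightarrow> top_value x y k (G_X var_x var_y k) (c k)"
      by metis
    then have IH: "top_value x y (Suc (Suc (Suc (Suc (Suc m))))) (G_X var_x var_y (Suc (Suc (Suc (Suc (Suc m)))))) (c (m + 5))"
      "top_value x y (Suc (Suc (Suc (Suc m)))) (G_X var_x var_y (Suc (Suc (Suc (Suc m))))) (c (m + 4))"
      "top_value x y (Suc (Suc (Suc m))) (G_X var_x var_y (Suc (Suc (Suc m)))) (c (m + 3))"
      "top_value x y (Suc (Suc m)) (G_X var_x var_y (Suc (Suc m))) (c (m + 2))"
      "top_value x y (Suc m) (G_X var_x var_y (Suc m)) (c (m + 1))"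
      "top_value x y m (G_X var_x var_y m) (c m)"
      by (simp_all add: 7 eval_nat_numeral)
    show ?thesis
      unfolding 7 G_X.simps
      \<comment> \<open>The witness stays schematic while the rules compute the value, and
        \<open>refl\<close> finally instantiates it.\<close>
      by (intro exI, rule top_value_cong, (rule top_value_rules IH)+) (simp, rule refl)
  qed (simp_all only: G_X.simps, (intro exI, rule top_value_cong, (rule top_value_rules)+, simp, rule refl)+)
qed

text \<open>With \<open>u = -x^3\<close>, the even leading forms are multiplied by \<open>u\<close>
  at each step. The odd ones also receive \<open>y\<close> times the preceding even form
  \<open>2 u^k\<close>, so their coefficient grows by 2:
  \<open>2 u^k y + u (2 k - 1) u^(k-1) y = (2 k + 1) u^k y\<close>. At \<open>k = 0\<close> the even
  value is 6 instead of 2, hence the restriction to \<open>k \<ge> 1\<close>.\<close>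

lemma top_value_G_Y_parity:
  fixes x y :: "'a::field_char_0"
  shows "(\<exists>c. top_value x y (3 * k) (G_Y var_x var_y (2 * k)) c \<and> (k \<ge> 1 \<longrightarrow> c = 2 * (- (x ^ 3)) ^ k)) \<and>
    top_value x y (Suc (3 * k)) (G_Y var_x var_y (Suc (2 * k))) ((2 * of_nat k + 1) * (- (x ^ 3)) ^ k * y)"
proof (induction k rule: less_induct)
  case (less k)
  consider "k = 0" | "k = Suc 0" | "k = Suc (Suc 0)" | j where "k = Suc (Suc (Suc j))"
    by (metis not0_implies_Suc)
  then show ?case
  proof cases
    case 1
    then show ?thesis using top_value_numeral[of x y] top_value_var_y[of x y] by auto
  next
    case 2
    then have idx: "2 * k = Suc (Suc 0)" by simp
    have "top_value x y (3 * k) (G_Y var_x var_y (2 * k)) (2 * (- (x ^ 3)) ^ k)"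
      unfolding idx G_Y.simps
      by (rule top_value_cong, (rule top_value_rules)+) (simp_all add: 2)
    moreover have "top_value x y (Suc (3 * k)) (G_Y var_x var_y (Suc (2 * k))) ((2 * of_nat k + 1) * (- (x ^ 3)) ^ k * y)"
      unfolding idx G_Y.simps
      by (rule top_value_cong, (rule top_value_rules)+) (simp_all add: 2)
    ultimately show ?thesis by blast
  next
    case 3
    then have idx: "2 * k = Suc (Suc (Suc (Suc 0)))" by simp
    have "top_value x y (3 * k) (G_Y var_x var_y (2 * k)) (2 * (- (x ^ 3)) ^ k)"
      unfolding idx G_Y.simps
      by (rule top_value_cong, (rule top_value_rules)+) (simp_all add: 3 power2_eq_square flip: power_add)
    moreover have "top_value x y (Suc (3 * k)) (G_Y var_x var_y (Suc (2 * k))) ((2 * of_nat k + 1) * (- (x ^ 3)) ^ k * y)"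
      unfolding idx G_Y.simps
      by (rule top_value_cong, (rule top_value_rules)+) (simp_all add: 3 power2_eq_square flip: power_add)
    ultimately show ?thesis by blast
  next
    case 4
    define m where "m = 2 * j"
    let ?u = "- (x ^ 3)"
    have idx: "2 * Suc j = Suc (Suc m)" "2 * Suc (Suc j) = Suc (Suc (Suc (Suc m)))" "2 * j = m"
      by (simp_all add: m_def)
    have lt: "j < k" "Suc j < k" "Suc (Suc j) < k" and ge: "Suc j \<ge> 1" "Suc (Suc j) \<ge> 1"
      by (simp_all add: 4)
    note IH = less.IH[OF lt(1)] less.IH[OF lt(2)] less.IH[OF lt(3)]
    obtain c where c: "top_value x y (3 * j) (G_Y var_x var_y m) c"
      using IH(1) unfolding idx by blast
    have even: "top_value x y (3 * Suc j) (G_Y var_x var_y (Suc (Suc m))) (2 * ?u ^ Suc j)"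
      "top_value x y (3 * Suc (Suc j)) (G_Y var_x var_y (Suc (Suc (Suc (Suc m))))) (2 * ?u ^ Suc (Suc j))"
      using conjunct1[OF IH(2)] conjunct1[OF IH(3)] ge unfolding idx by blast+
    note odd = conjunct2[OF IH(1), unfolded idx] conjunct2[OF IH(2), unfolded idx]
      conjunct2[OF IH(3), unfolded idx]
    \<comment> \<open>All degrees become \<open>D\<close> plus a numeral, so that simplification
      decides the comparisons made by the rules.\<close>
    define D where "D = 3 * j"
    have deg: "3 * j = D" "3 * Suc j = D + 3" "3 * Suc (Suc j) = D + 6" "3 * k = D + 9"
      by (simp_all add: D_def 4)
    note tops = c[unfolded deg] even[unfolded deg] odd[unfolded deg]
    have even': "top_value x y (3 * k) (G_Y var_x var_y (Suc (Suc (Suc (Suc (Suc (Suc m))))))) (2 * ?u ^ k)"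
      unfolding deg G_Y.simps
      by (rule top_value_cong, (rule top_value_rules tops)+) (simp_all add: 4)
    \<comment> \<open>The odd step uses the even form of the same \<open>k\<close>, obtained just
      before.\<close>
    have odd': "top_value x y (Suc (3 * k)) (G_Y var_x var_y (Suc (Suc (Suc (Suc (Suc (Suc (Suc m)))))))) ((2 * of_nat k + 1) * ?u ^ k * y)"
      unfolding deg G_Y.simps
      by (rule top_value_cong, (rule top_value_rules tops even'[unfolded deg])+)
        (simp_all add: 4 algebra_simps)
    have "2 * k = Suc (Suc (Suc (Suc (Suc (Suc m)))))" by (simp add: 4 m_def)
    then show ?thesis using even' odd' by (simp only:) blast
  qed
qed

section \<open>The composition law for the maps \<open>G\<^sub>n\<close>\<close>

lemma recurrence_6:
  fixes t :: "'a::field"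
  assumes "t ^ 6 = a * (t ^ 5 + t) - b * (t ^ 4 + t ^ 2) + c * t ^ 3 - 1"
  shows "t ^ Suc (Suc (Suc (Suc (Suc (Suc n))))) = a * (t ^ Suc (Suc (Suc (Suc (Suc n)))) + t ^ Suc n)
    - b * (t ^ Suc (Suc (Suc (Suc n))) + t ^ Suc (Suc n)) + c * t ^ Suc (Suc (Suc n)) - t ^ n"
proof -
  have "t ^ Suc (Suc (Suc (Suc (Suc (Suc n))))) = t ^ n * t ^ 6"
    by (simp add: eval_nat_numeral)
  then show ?thesis
    unfolding assms by (simp add: eval_nat_numeral algebra_simps)
qed

text \<open>
  The characteristic polynomial of the recurrence for \<open>X\<^sub>n\<close> is
  \<open>(t\<^sup>3 - p t\<^sup>2 + q t - 1) (t\<^sup>3 - q t\<^sup>2 + p t - 1)\<close> for \<open>x = p + q\<close>, \<open>y = p q - 3\<close>.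
\<close>

lemma G_X_char:
  fixes t :: "'a::field"
  assumes "t ^ 3 = p * t ^ 2 - q * t + 1" "x = p + q" "y = p * q - 3"
  shows "t ^ 6 = x * (t ^ 5 + t) - (x + y + 3) * (t ^ 4 + t ^ 2) + (x ^ 2 - 2 * y - 4) * t ^ 3 - 1"
proof -
  have "t ^ 6 - (x * (t ^ 5 + t) - (x + y + 3) * (t ^ 4 + t ^ 2) + (x ^ 2 - 2 * y - 4) * t ^ 3 - 1) =
      (t ^ 3 - (p * t ^ 2 - q * t + 1)) * (t ^ 3 - (q * t ^ 2 - p * t + 1))"
    unfolding assms(2,3) by algebra
  then show ?thesis by (simp add: assms(1))
qed

text \<open>
  The characteristic polynomial of the recurrence for \<open>Y\<^sub>n\<close> is the product of the three polynomials
  \<open>t\<^sup>2 - s\<^sub>i t + 1\<close>.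
\<close>

lemma G_Y_char:
  fixes t :: "'a::field"
  assumes "t * t' = 1" "s\<^sub>1 = t + t'" "y = s\<^sub>1 + s\<^sub>2 + s\<^sub>3"
    and "e = s\<^sub>1 * s\<^sub>2 + s\<^sub>1 * s\<^sub>3 + s\<^sub>2 * s\<^sub>3 + 3" "f = s\<^sub>1 * s\<^sub>2 * s\<^sub>3 + 2 * y"
  shows "t ^ 6 = y * (t ^ 5 + t) - e * (t ^ 4 + t ^ 2) + f * t ^ 3 - 1"
proof -
  have *: "t ^ 2 - s\<^sub>1 * t + 1 = 0"
    using assms(1) unfolding assms(2) by algebra
  have "t ^ 6 - (y * (t ^ 5 + t) - e * (t ^ 4 + t ^ 2) + f * t ^ 3 - 1) =
      (t ^ 2 - s\<^sub>1 * t + 1) * (t ^ 2 - s\<^sub>2 * t + 1) * (t ^ 2 - s\<^sub>3 * t + 1)"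
    unfolding assms(3-5) by algebra
  then show ?thesis by (simp add: *)
qed

text \<open>Vieta: \<open>u\<close>, \<open>v\<close>, \<open>w\<close> are the roots of
  \<open>t^3 - p t^2 + q t - 1\<close>.\<close>

lemma cubic_root:
  fixes t u v w :: "'a::field"
  assumes "u * v * w = 1" "p = u + v + w" "q = v * w + u * w + u * v" "t = u \<or> t = v \<or> t = w"
  shows "t ^ 3 = p * t ^ 2 - q * t + 1"
proof -
  have "(t - u) * (t - v) * (t - w) = t ^ 3 - (p * t ^ 2 - q * t + 1)"
    using assms(1) unfolding assms(2,3) by algebra
  then show ?thesis using assms(4) by auto
qed

text \<open>Newton's identities with third elementary symmetric function 1, used for the initial
  values of the recurrences.\<close>

lemma power_sums_3:
  fixes u v w :: "'a::field"
  assumes uvw: "u * v * w = 1" and p: "p = u + v + w" and q: "q = v * w + u * w + u * v"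
  shows "u ^ 2 + v ^ 2 + w ^ 2 = p ^ 2 - 2 * q"
    and "u ^ 3 + v ^ 3 + w ^ 3 = p ^ 3 - 3 * p * q + 3"
    and "u ^ 4 + v ^ 4 + w ^ 4 = p ^ 4 - 4 * p ^ 2 * q + 2 * q ^ 2 + 4 * p"
    and "u ^ 5 + v ^ 5 + w ^ 5 = p ^ 5 - 5 * p ^ 3 * q + 5 * p * q ^ 2 + 5 * p ^ 2 - 5 * q"
proof -
  note root = cubic_root[OF assms]
  show 2: "u ^ 2 + v ^ 2 + w ^ 2 = p ^ 2 - 2 * q" unfolding p q by algebra
  have "u ^ 3 + v ^ 3 + w ^ 3 = p * (u ^ 2 + v ^ 2 + w ^ 2) - q * (u + v + w) + 3"
    by (simp add: root) (simp add: algebra_simps)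
  then show 3: "u ^ 3 + v ^ 3 + w ^ 3 = p ^ 3 - 3 * p * q + 3"
    unfolding 2 p[symmetric] by algebra
  have roots: "u ^ 3 = p * u ^ 2 - q * u + 1" "v ^ 3 = p * v ^ 2 - q * v + 1" "w ^ 3 = p * w ^ 2 - q * w + 1"
    by (simp_all only: root simp_thms)
  have "u ^ 4 = p * u ^ 3 - q * u ^ 2 + u" "v ^ 4 = p * v ^ 3 - q * v ^ 2 + v"
    "w ^ 4 = p * w ^ 3 - q * w ^ 2 + w"
    using roots by algebra+
  then have "u ^ 4 + v ^ 4 + w ^ 4 =
      p * (u ^ 3 + v ^ 3 + w ^ 3) - q * (u ^ 2 + v ^ 2 + w ^ 2) + (u + v + w)"
    by algebra
  then show 4: "u ^ 4 + v ^ 4 + w ^ 4 = p ^ 4 - 4 * p ^ 2 * q + 2 * q ^ 2 + 4 * p"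
    unfolding 2 3 p[symmetric] by algebra
  have "u ^ 5 = p * u ^ 4 - q * u ^ 3 + u ^ 2" "v ^ 5 = p * v ^ 4 - q * v ^ 3 + v ^ 2"
    "w ^ 5 = p * w ^ 4 - q * w ^ 3 + w ^ 2"
    using roots by algebra+
  then have "u ^ 5 + v ^ 5 + w ^ 5 =
      p * (u ^ 4 + v ^ 4 + w ^ 4) - q * (u ^ 3 + v ^ 3 + w ^ 3) + (u ^ 2 + v ^ 2 + w ^ 2)"
    by algebra
  then show "u ^ 5 + v ^ 5 + w ^ 5 = p ^ 5 - 5 * p ^ 3 * q + 5 * p * q ^ 2 + 5 * p ^ 2 - 5 * q"
    unfolding 2 3 4 by algebra
qed

text \<open>Since \<open>u v w = 1\<close>, the six monomials are the ratios of two of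
  \<open>u, v, w\<close>, for instance \<open>u^2 v = u / w\<close>. Each \<open>s\<^sub>i\<close>
  sums a ratio and its inverse, and the claims identify the coefficients of the recurrence for
  \<open>Y_n\<close> with those required by \<open>G_Y_char\<close>.\<close>

lemma Y_symmetric_functions:
  fixes u v w :: "'a::field"
  assumes uvw: "u * v * w = 1" and p: "p = u + v + w" and q: "q = v * w + u * w + u * v"
    and x: "x = p + q" and y: "y = p * q - 3"
    and s: "s\<^sub>1 = u ^ 2 * v + v * w ^ 2" "s\<^sub>2 = u ^ 2 * w + v ^ 2 * w" "s\<^sub>3 = u * v ^ 2 + u * w ^ 2"
  shows "y = s\<^sub>1 + s\<^sub>2 + s\<^sub>3"
    and "x ^ 3 - 3 * x * y - 9 * x - 5 * y - 9 = s\<^sub>1 * s\<^sub>2 + s\<^sub>1 * s\<^sub>3 + s\<^sub>2 * s\<^sub>3 + 3"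
    and "y ^ 2 - 2 * x ^ 3 + 6 * x * y + 18 * x + 12 * y + 20 = s\<^sub>1 * s\<^sub>2 * s\<^sub>3 + 2 * y"
  subgoal using uvw unfolding x y p q s by algebra
  subgoal using uvw unfolding x y p q s by algebra
  subgoal using uvw unfolding x y p q s by algebra
  done

text \<open>
  Every point of the plane has the form \<open>(p + q, p q - 3)\<close>, where \<open>p\<close> and \<open>q\<close> are the first two
  elementary symmetric functions of \<open>u, v, w\<close> with \<open>u v w = 1\<close>. In these coordinates the \<open>n\<close>-th
  folding map is \<open>(u, v, w) \<mapsto> (u\<^sup>n, v\<^sup>n, w\<^sup>n)\<close>. The inverses \<open>1 / u\<close> are written \<open>v w\<close>.
\<close>

definition G_param :: "'a::field \<Rightarrow> 'a \<Rightarrow> 'a \<Rightarrow> 'a \<Rightarrow> 'a \<Rightarrow> bool" where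
  "G_param u v w x y \<longleftrightarrow> u * v * w = 1 \<and> x = (u + v + w) + (v * w + u * w + u * v) \<and>
     y = (u + v + w) * (v * w + u * w + u * v) - 3"

lemma ex_G_param: "\<exists>u v w. G_param u v w x (y :: 'a::alg_closed_field)"
proof -
  \<comment> \<open>\<open>p\<close> and \<open>q = x - p\<close> are the roots of
    \<open>t^2 - x t + (y + 3)\<close>.\<close>
  obtain p where "poly [:y + 3, - x, 1:] p = 0"
    using alg_closed_imp_poly_has_root[of "[:y + 3, - x, 1:]"] by auto
  then have y: "y = p * (x - p) - 3" by (simp add: algebra_simps)
  define q where "q = x - p"
  obtain u where "poly [:- 1, q, - p, 1:] u = 0"
    using alg_closed_imp_poly_has_root[of "[:- 1, q, - p, 1:]"] by auto
  then have u: "u ^ 3 - p * u ^ 2 + q * u - 1 = 0"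
    by (simp add: algebra_simps power2_eq_square power3_eq_cube)
  then have "u \<noteq> 0" by auto
  \<comment> \<open>Dividing the cubic by \<open>t - u\<close> leaves
    \<open>t^2 + (u - p) t + 1 / u\<close>.\<close>
  obtain v where "poly [:1 / u, u - p, 1:] v = 0"
    using alg_closed_imp_poly_has_root[of "[:1 / u, u - p, 1:]"] by auto
  then have v: "v ^ 2 + (u - p) * v + 1 / u = 0"
    by (simp add: algebra_simps power2_eq_square)
  then have "v \<noteq> 0" using \<open>u \<noteq> 0\<close> by auto
  define w where "w = 1 / (u * v)"
  have uvw: "u * v * w = 1" using \<open>u \<noteq> 0\<close> \<open>v \<noteq> 0\<close> by (simp add: w_def)
  have "v * (u + v + w - p) = v ^ 2 + (u - p) * v + 1 / u"
    using \<open>u \<noteq> 0\<close> \<open>v \<noteq> 0\<close> by (simp add: w_def field_simps power2_eq_square)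
  then have p: "p = u + v + w" using v \<open>v \<noteq> 0\<close> by simp
  have "u * (v * w + u * w + u * v - q) = - (u ^ 3 - p * u ^ 2 + q * u - 1)"
    using uvw unfolding p by algebra
  then have q: "q = v * w + u * w + u * v" using u \<open>u \<noteq> 0\<close> by simp
  have "x = p + q" "y = p * q - 3" by (simp_all add: q_def y)
  then show ?thesis unfolding G_param_def using uvw p q by metis
qed

text \<open>The six powers are those of the characteristic roots, so both sides obey the same
  recurrence and agree once the six initial values do.\<close>

lemma G_X_param:
  assumes "G_param u v w x y"
  shows "G_X x y n = (u ^ n + v ^ n + w ^ n) + ((v * w) ^ n + (u * w) ^ n + (u * v) ^ n)"
proof -
  define p q where "p = u + v + w" and "q = v * w + u * w + u * v"
  have uvw: "u * v * w = 1" and x: "x = p + q" and y: "y = p * q - 3"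
    using assms by (simp_all add: G_param_def p_def q_def)
  \<comment> \<open>The inverses \<open>v w\<close>, \<open>u w\<close>, \<open>u v\<close> again
    have product 1, with \<open>p\<close> and \<open>q\<close> exchanged, so the lemmas on three
    numbers apply to them too.\<close>
  have inv: "(v * w) * (u * w) * (u * v) = 1" "q = v * w + u * w + u * v"
    "p = (u * w) * (u * v) + (v * w) * (u * v) + (v * w) * (u * w)"
    using uvw unfolding p_def q_def by (algebra, simp, algebra)
  note sums = power_sums_3[OF uvw p_def q_def] power_sums_3[OF inv]
  have X: "t ^ 6 = x * (t ^ 5 + t) - (x + y + 3) * (t ^ 4 + t ^ 2) + (x ^ 2 - 2 * y - 4) * t ^ 3 - 1"
    if "t = u \<or> t = v \<or> t = w" for t
    using cubic_root[OF uvw p_def q_def that] x y by (rule G_X_char)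
  have X': "t ^ 6 = x * (t ^ 5 + t) - (x + y + 3) * (t ^ 4 + t ^ 2) + (x ^ 2 - 2 * y - 4) * t ^ 3 - 1"
    if "t = v * w \<or> t = u * w \<or> t = u * v" for t
    by (rule G_X_char[OF cubic_root[OF inv that]]) (simp_all add: x y)
  note rec = recurrence_6[OF X[of u]] recurrence_6[OF X[of v]] recurrence_6[OF X[of w]]
    recurrence_6[OF X'[of "v * w"]] recurrence_6[OF X'[of "u * w"]] recurrence_6[OF X'[of "u * v"]]
  have base: "G_X x y (Suc (Suc 0)) = (u ^ 2 + v ^ 2 + w ^ 2) + ((v * w) ^ 2 + (u * w) ^ 2 + (u * v) ^ 2)"
    "G_X x y (Suc (Suc (Suc 0))) = (u ^ 3 + v ^ 3 + w ^ 3) + ((v * w) ^ 3 + (u * w) ^ 3 + (u * v) ^ 3)"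
    "G_X x y (Suc (Suc (Suc (Suc 0)))) = (u ^ 4 + v ^ 4 + w ^ 4) + ((v * w) ^ 4 + (u * w) ^ 4 + (u * v) ^ 4)"
    "G_X x y (Suc (Suc (Suc (Suc (Suc 0))))) = (u ^ 5 + v ^ 5 + w ^ 5) + ((v * w) ^ 5 + (u * w) ^ 5 + (u * v) ^ 5)"
    unfolding G_X.simps sums unfolding x y by algebra+
  show ?thesis
  proof (induction n rule: less_induct)
    case (less n)
    consider "n = 0" | "n = Suc 0" | "n = Suc (Suc 0)" | "n = Suc (Suc (Suc 0))" | "n = Suc (Suc (Suc (Suc 0)))" | "n = Suc (Suc (Suc (Suc (Suc 0))))"
      | m where "n = Suc (Suc (Suc (Suc (Suc (Suc m)))))"
      by (metis not0_implies_Suc)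
    then show ?case
    proof cases
      case 1
      then show ?thesis by simp
    next
      case 2
      then show ?thesis by (simp add: x p_def q_def)
    next
      case 3
      show ?thesis unfolding 3 using base(1) by (simp only: eval_nat_numeral BitM.simps)
    next
      case 4
      show ?thesis unfolding 4 using base(2) by (simp only: eval_nat_numeral BitM.simps)
    next
      case 5
      show ?thesis unfolding 5 using base(3) by (simp only: eval_nat_numeral BitM.simps)
    next
      case 6
      show ?thesis unfolding 6 using base(4) by (simp only: eval_nat_numeral BitM.simps)
    next
      case 7
      have IH: "G_X x y k = (u ^ k + v ^ k + w ^ k) + ((v * w) ^ k + (u * w) ^ k + (u * v) ^ k)"
        if "k < Suc (Suc (Suc (Suc (Suc (Suc m)))))" for k
        using less.IH that unfolding 7 by blast
      show ?thesis
        unfolding 7 G_X.simps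
        by (simp only: IH lessI less_SucI rec simp_thms) (simp only: algebra_simps)
    qed
  qed
qed

text \<open>Expanding the product gives the sum of the \<open>n\<close>-th powers of the six ratios,
  and each of these satisfies the recurrence for \<open>Y_n\<close>.\<close>

lemma G_Y_param:
  assumes "G_param u v w x y"
  shows "G_Y x y n = (u ^ n + v ^ n + w ^ n) * ((v * w) ^ n + (u * w) ^ n + (u * v) ^ n) - 3"
proof -
  define p q where "p = u + v + w" and "q = v * w + u * w + u * v"
  have uvw: "u * v * w = 1" and x: "x = p + q" and y: "y = p * q - 3"
    using assms by (simp_all add: G_param_def p_def q_def)
  have inv: "(v * w) * (u * w) * (u * v) = 1" "q = v * w + u * w + u * v"
    "p = (u * w) * (u * v) + (v * w) * (u * v) + (v * w) * (u * w)"
    using uvw unfolding p_def q_def by (algebra, simp, algebra)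
  note sums = power_sums_3[OF uvw p_def q_def] power_sums_3[OF inv]
  let ?r = "\<lambda>n. (u ^ 2 * v) ^ n + (v * w ^ 2) ^ n + (u ^ 2 * w) ^ n + (v ^ 2 * w) ^ n + (u * v ^ 2) ^ n + (u * w ^ 2) ^ n"
  \<comment> \<open>The three products of a power with its inverse equal 1 and are removed by the
    3.\<close>
  have prod: "(u ^ n + v ^ n + w ^ n) * ((v * w) ^ n + (u * w) ^ n + (u * v) ^ n) - 3 = ?r n" for n
  proof -
    have "(u ^ n) * (v ^ n) * (w ^ n) = 1" by (simp add: uvw flip: power_mult_distrib)
    moreover have "(a ^ 2) ^ n = (a ^ n) ^ 2" for a :: 'a by (simp add: mult.commute flip: power_mult)
    moreover have "(a + b + c) * (b * c + a * c + a * b) - 3 =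
        a ^ 2 * b + b * c ^ 2 + a ^ 2 * c + b ^ 2 * c + a * b ^ 2 + a * c ^ 2"
      if "a * b * c = 1" for a b c :: 'a
      using that by algebra
    ultimately show ?thesis by (simp only: power_mult_distrib)
  qed
  define s\<^sub>1 s\<^sub>2 s\<^sub>3 where s: "s\<^sub>1 = u ^ 2 * v + v * w ^ 2" "s\<^sub>2 = u ^ 2 * w + v ^ 2 * w" "s\<^sub>3 = u * v ^ 2 + u * w ^ 2"
  define e f where e: "e = x ^ 3 - 3 * x * y - 9 * x - 5 * y - 9"
    and f: "f = y ^ 2 - 2 * x ^ 3 + 6 * x * y + 18 * x + 12 * y + 20"
  note sym = Y_symmetric_functions[OF uvw p_def q_def x y s, folded e f]
  have rec: "t ^ Suc (Suc (Suc (Suc (Suc (Suc n))))) = y * (t ^ Suc (Suc (Suc (Suc (Suc n)))) + t ^ Suc n)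
    - e * (t ^ Suc (Suc (Suc (Suc n))) + t ^ Suc (Suc n)) + f * t ^ Suc (Suc (Suc n)) - t ^ n"
    if t: "t \<in> {u ^ 2 * v, v * w ^ 2, u ^ 2 * w, v ^ 2 * w, u * v ^ 2, u * w ^ 2}" for t n
  proof (rule recurrence_6)
    have "(u ^ 2 * v) * (v * w ^ 2) = 1" "(u ^ 2 * w) * (v ^ 2 * w) = 1" "(u * v ^ 2) * (u * w ^ 2) = 1"
      using uvw by algebra+
    \<comment> \<open>\<open>t'\<close> is the inverse ratio, paired with \<open>t\<close> in one of
      the \<open>s\<^sub>i\<close>.\<close>
    then obtain t' where t': "t * t' = 1" "t + t' \<in> {s\<^sub>1, s\<^sub>2, s\<^sub>3}"
      using t unfolding s by (metis insert_iff empty_iff mult.commute add.commute)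
    from t'(2) consider "s\<^sub>1 = t + t'" | "s\<^sub>2 = t + t'" | "s\<^sub>3 = t + t'" by auto
    then show "t ^ 6 = y * (t ^ 5 + t) - e * (t ^ 4 + t ^ 2) + f * t ^ 3 - 1"
    proof cases
      case 1
      then show ?thesis by (rule G_Y_char[OF t'(1)]) (fact sym)+
    next
      case 2
      then show ?thesis
        by (rule G_Y_char[OF t'(1), of s\<^sub>2 y s\<^sub>1 s\<^sub>3]) (simp_all add: sym mult_ac add_ac)
    next
      case 3
      then show ?thesis
        by (rule G_Y_char[OF t'(1), of s\<^sub>3 y s\<^sub>1 s\<^sub>2]) (simp_all add: sym mult_ac add_ac)
    qed
  qed
  have base: "G_Y x y (Suc (Suc 0)) = (u ^ 2 + v ^ 2 + w ^ 2) * ((v * w) ^ 2 + (u * w) ^ 2 + (u * v) ^ 2) - 3"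
    "G_Y x y (Suc (Suc (Suc 0))) = (u ^ 3 + v ^ 3 + w ^ 3) * ((v * w) ^ 3 + (u * w) ^ 3 + (u * v) ^ 3) - 3"
    "G_Y x y (Suc (Suc (Suc (Suc 0)))) = (u ^ 4 + v ^ 4 + w ^ 4) * ((v * w) ^ 4 + (u * w) ^ 4 + (u * v) ^ 4) - 3"
    "G_Y x y (Suc (Suc (Suc (Suc (Suc 0))))) = (u ^ 5 + v ^ 5 + w ^ 5) * ((v * w) ^ 5 + (u * w) ^ 5 + (u * v) ^ 5) - 3"
    unfolding G_Y.simps sums unfolding x y by algebra+
  have "G_Y x y n = ?r n"
  proof (induction n rule: less_induct)
    case (less n)
    consider "n = 0" | "n = Suc 0" | "n = Suc (Suc 0)" | "n = Suc (Suc (Suc 0))" | "n = Suc (Suc (Suc (Suc 0)))" | "n = Suc (Suc (Suc (Suc (Suc 0))))"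
      | m where "n = Suc (Suc (Suc (Suc (Suc (Suc m)))))"
      by (metis not0_implies_Suc)
    then show ?case
    proof cases
      case 1
      then show ?thesis by simp
    next
      case 2
      show ?thesis unfolding 2 prod[symmetric] by (simp add: y p_def q_def)
    next
      case 3
      show ?thesis unfolding 3 unfolding prod[symmetric] using base(1) by (simp only: eval_nat_numeral BitM.simps)
    next
      case 4
      show ?thesis unfolding 4 unfolding prod[symmetric] using base(2) by (simp only: eval_nat_numeral BitM.simps)
    next
      case 5
      show ?thesis unfolding 5 unfolding prod[symmetric] using base(3) by (simp only: eval_nat_numeral BitM.simps)
    next
      case 6
      show ?thesis unfolding 6 unfolding prod[symmetric] using base(4) by (simp only: eval_nat_numeral BitM.simps)
    next
      case 7
      have IH: "G_Y x y k = ?r k"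
        if "k < Suc (Suc (Suc (Suc (Suc (Suc m)))))" for k
        using less.IH that unfolding 7 by blast
      show ?thesis
        unfolding 7 G_Y.simps e[symmetric] f[symmetric]
        by (simp only: IH lessI less_SucI rec insert_iff simp_thms) (simp only: algebra_simps)
    qed
  qed
  then show ?thesis by (simp only: prod)
qed

lemma G_param_power:
  assumes "G_param u v w x y"
  shows "G_param (u ^ n) (v ^ n) (w ^ n) (G_X x y n) (G_Y x y n)"
proof -
  have "u ^ n * v ^ n * w ^ n = 1"
    using assms by (simp add: G_param_def flip: power_mult_distrib)
  then show ?thesis
    by (simp add: G_param_def G_X_param[OF assms] G_Y_param[OF assms] power_mult_distrib)
qed

text \<open>Every point is parametrized, and in the parameters the claim is
  \<open>(u^m)^n = u^(m*n)\<close>.\<close>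

lemma G_comp:
  fixes x y :: "'a::alg_closed_field"
  shows "G_X (G_X x y m) (G_Y x y m) n = G_X x y (m * n)"
    and "G_Y (G_X x y m) (G_Y x y m) n = G_Y x y (m * n)"
proof -
  obtain u v w where *: "G_param u v w x y" using ex_G_param by blast
  show "G_X (G_X x y m) (G_Y x y m) n = G_X x y (m * n)"
    by (simp only: G_X_param[OF G_param_power[OF *]] G_X_param[OF *, of "m * n"] power_mult power_mult_distrib)
  show "G_Y (G_X x y m) (G_Y x y m) n = G_Y x y (m * n)"
    by (simp only: G_Y_param[OF G_param_power[OF *]] G_Y_param[OF *, of "m * n"] power_mult power_mult_distrib)
qed

section \<open>The homogenized folding maps\<close>

text \<open>If both leading forms vanish, then \<open>x + i y = x - i y = 0\<close>, so
  \<open>x = y = 0\<close> in characteristic 0. Hence there are no common zeros at infinity.\<close>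

lemma folding_A_nondegenerate:
  assumes "n \<ge> 1"
  shows "exact_degree n (folding_A n :: 'a::{alg_closed_field, field_char_0} poly2 \<times> 'a poly2)"
    and "zero_locus (hom_triple n (folding_A n :: 'a::{alg_closed_field, field_char_0} poly2 \<times> 'a poly2)) = {}"
proof -
  obtain i :: 'a where i: "i ^ 2 = - 1"
    using nth_root_exists[of 2 "- 1 :: 'a"] by auto
  let ?X = "A_X var_x var_y n :: 'a poly2" and ?Y = "A_Y var_x var_y n :: 'a poly2"
  have deg: "total_degree2 ?X \<le> n" "total_degree2 ?Y \<le> n"
    using top_value_A[OF i assms, of 0 0] by (auto simp: top_value_def)
  have top: "x = 0 \<and> y = 0"
    if "eval3 (homogenize n ?X) (x, y, 0) = 0" "eval3 (homogenize n ?Y) (x, y, 0) = 0" for x y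
  proof -
    have "(x + i * y) ^ n = 0" "(x - i * y) ^ n = 0"
      using top_value_A[OF i assms, of x y] that by (auto simp: top_value_def)
    then have "x + i * y = 0" "x - i * y = 0" by simp_all
    then have "2 * x = 0" "2 * (i * y) = 0" by algebra+
    moreover have "i \<noteq> 0" using i by auto
    ultimately show ?thesis by simp
  qed
  show "exact_degree n (folding_A n :: 'a poly2 \<times> 'a poly2)"
    using deg top[of 1 0] by (auto simp: exact_degree_def folding_A_def)
  show "zero_locus (hom_triple n (folding_A n :: 'a poly2 \<times> 'a poly2)) = {}"
    using top unfolding folding_A_def zero_locus_hom_triple[OF assms] by blast
qed

text \<open>The leading form \<open>x^n\<close> of \<open>X_n\<close> forces \<open>x = 0\<close>,
  and there that of \<open>Y_n\<close> is \<open>y^n\<close>.\<close>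

lemma folding_B_nondegenerate:
  assumes "n \<ge> 1"
  shows "exact_degree n (folding_B n :: 'a::field_char_0 poly2 \<times> 'a poly2)"
    and "zero_locus (hom_triple n (folding_B n :: 'a::field_char_0 poly2 \<times> 'a poly2)) = {}"
proof -
  let ?X = "B_X var_x var_y n :: 'a poly2" and ?Y = "B_Y var_x var_y n :: 'a poly2"
  have deg: "total_degree2 ?X \<le> n" "total_degree2 ?Y \<le> n"
    using top_value_B_X[OF assms, of 0 0] top_value_B_Y[OF assms, of 0] by (auto simp: top_value_def)
  have top: "x = 0 \<and> y = 0"
    if "eval3 (homogenize n ?X) (x, y, 0) = 0" "eval3 (homogenize n ?Y) (x, y, 0) = 0" for x y
  proof -
    have "x = 0" using top_value_B_X[OF assms, of x y] that by (auto simp: top_value_def)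
    then show ?thesis using top_value_B_Y[OF assms, of y] that by (auto simp: top_value_def)
  qed
  show "exact_degree n (folding_B n :: 'a poly2 \<times> 'a poly2)"
    using deg top[of 1 0] by (auto simp: exact_degree_def folding_B_def)
  show "zero_locus (hom_triple n (folding_B n :: 'a poly2 \<times> 'a poly2)) = {}"
    using top unfolding folding_B_def zero_locus_hom_triple[OF assms] by blast
qed

definition G_top :: "'a::comm_ring_1 \<Rightarrow> 'a \<Rightarrow> nat \<Rightarrow> 'a" where
  "G_top x y n = (if even n then 2 * (- (x ^ 3)) ^ (n div 2) else of_nat n * (- (x ^ 3)) ^ (n div 2) * y)"

lemma top_value_G_Y:
  fixes x y :: "'a::field_char_0"
  assumes "n \<ge> 1"
  shows "top_value x y (3 * n div 2) (G_Y var_x var_y n) (G_top x y n)"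
proof (cases "even n")
  case True
  then obtain k where "n = 2 * k" by (elim evenE)
  then show ?thesis using top_value_G_Y_parity[of x y k] assms by (auto simp: G_top_def)
next
  case False
  then obtain k where k: "n = 2 * k + 1" by (elim oddE)
  then have "3 * n div 2 = Suc (3 * k)" by simp
  then show ?thesis using top_value_G_Y_parity[of x y k] k by (simp add: G_top_def algebra_simps)
qed

lemma total_degree2_G_X: "total_degree2 (G_X var_x var_y n :: 'a::field_char_0 poly2) \<le> n"
  using top_value_G_X[of 0 0 n] by (auto simp: top_value_def)

lemma exact_degree_G:
  assumes "n \<ge> 1"
  shows "exact_degree (3 * n div 2) (folding_G n :: 'a::field_char_0 poly2 \<times> 'a poly2)"
proof -
  have "n \<le> 3 * n div 2" by linarith
  then have "total_degree2 (G_X var_x var_y n :: 'a poly2) \<le> 3 * n div 2"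
    using total_degree2_G_X[of n] by (rule order_trans[rotated])
  \<comment> \<open>At \<open>(1, 1)\<close> the form is 2 or \<open>n\<close> up to sign, nonzero
    in characteristic 0.\<close>
  moreover have "G_top 1 1 n \<noteq> (0 :: 'a)" using assms by (auto simp: G_top_def)
  ultimately show ?thesis
    using top_value_G_Y[OF assms, of "1 :: 'a" 1]
    unfolding exact_degree_def folding_G_def top_value_def prod.case by metis
qed

text \<open>For \<open>n \<ge> 2\<close> the bound \<open>n\<close> on the degree of
  \<open>X_n\<close> is below \<open>3 * n div 2\<close>, so the first component vanishes on
  \<open>Z = 0\<close> and the zeros there are those of \<open>G_top\<close>.\<close>

lemma zero_locus_G:
  assumes "n \<ge> 2"
  shows "zero_locus (hom_triple (3 * n div 2) (folding_G n :: 'a::field_char_0 poly2 \<times> 'a poly2)) =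
    (if even n then {proj_point 0 1 0} else {proj_point 0 1 0, proj_point 1 0 0})"
proof -
  have lt: "n < 3 * n div 2" "3 * n div 2 \<ge> 1" using assms by linarith+
  have X: "eval3 (homogenize (3 * n div 2) (G_X var_x var_y n)) (x, y, 0) = 0" for x y :: 'a
  proof -
    obtain c where "top_value x y n (G_X var_x var_y n) c" using top_value_G_X by blast
    then show ?thesis
      using top_value_raise[of x y n _ c "3 * n div 2"] lt by (simp add: top_value_def)
  qed
  \<comment> \<open>As \<open>n div 2 \<ge> 1\<close>, the power of \<open>x\<close> is present for
    both parities.\<close>
  have Y: "eval3 (homogenize (3 * n div 2) (G_Y var_x var_y n)) (x, y, 0) = 0 \<longleftrightarrow>
      x = 0 \<or> odd n \<and> y = 0" for x y :: 'a
    using top_value_G_Y[of n x y] assms by (auto simp: top_value_def G_top_def)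
  have "zero_locus (hom_triple (3 * n div 2) (folding_G n :: 'a poly2 \<times> 'a poly2)) =
      {proj_point x y 0 | x y. (x, y) \<noteq> (0, 0) \<and> (x = 0 \<or> odd n \<and> y = 0)}"
    unfolding folding_G_def zero_locus_hom_triple[OF lt(2)] by (simp add: X Y)
  also have "\<dots> = (if even n then {proj_point 0 1 0} else {proj_point 0 1 0, proj_point 1 0 0})"
    (is "?L = ?R")
  proof (intro equalityI subsetI)
    fix P assume "P \<in> ?L"
    then obtain x y where P: "P = proj_point x y 0" "(x, y) \<noteq> (0, 0)" "x = 0 \<or> odd n \<and> y = 0"
      by blast
    show "P \<in> ?R"
    proof (cases "x = 0")
      case True
      then have "P = proj_point 0 1 0" using P(1,2) proj_point_eqI[of y 0 1 0] by simp
      then show ?thesis by simp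
    next
      case False
      then have "P = proj_point 1 0 0" "odd n" using P proj_point_eqI[of x 1 0 0] by simp_all
      then show ?thesis by simp
    qed
  next
    fix P assume "P \<in> ?R"
    then consider "P = proj_point 0 1 0" | "P = proj_point 1 0 0" "odd n"
      by (auto split: if_splits)
    then show "P \<in> ?L"
    proof cases
      case 1
      then show ?thesis by (intro CollectI exI[of _ 0] exI[of _ 1]) simp
    next
      case 2
      then show ?thesis by (intro CollectI exI[of _ 1] exI[of _ 0]) simp
    qed
  qed
  finally show ?thesis .
qed

section \<open>Iterates of the third map and their degrees\<close>

lemma eval2_G_X: "eval2 (G_X p q n) x y = G_X (eval2 p x y) (eval2 q x y) n"
  by (induction p q n rule: G_X.induct) simp_all

lemma eval2_G_Y: "eval2 (G_Y p q n) x y = G_Y (eval2 p x y) (eval2 q x y) n"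
  by (induction p q n rule: G_Y.induct) simp_all

text \<open>The left side is \<open>3 a k\<close> for \<open>b = 2 k\<close> and
  \<open>3 a k + (3 a div 2)\<close> for \<open>b = 2 k + 1\<close>; replacing \<open>a\<close> by
  \<open>3 a div 2\<close> in the first term gives the right side.\<close>

lemma half_thrice_mult_le:
  assumes "a \<ge> 1" "b \<ge> 1"
  shows "3 * (a * b) div 2 \<le> (3 * a div 2) * (3 * b div 2 :: nat)"
proof (cases "even b")
  case True
  then obtain k where "b = 2 * k" by (elim evenE)
  moreover have "a \<le> 3 * a div 2" by linarith
  ultimately show ?thesis by (simp add: mult.left_commute mult_le_mono)
next
  case False
  then obtain k where b: "b = 2 * k + 1" by (elim oddE)
  have "3 * (a * b) div 2 = 3 * (a * k) + 3 * a div 2"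
  proof -
    have "3 * (a * b) = 3 * a + 2 * (3 * (a * k))" by (simp add: b algebra_simps)
    then show ?thesis by simp
  qed
  also have "\<dots> \<le> (3 * a div 2) * (3 * k) + 3 * a div 2"
  proof -
    have "a * (3 * k) \<le> (3 * a div 2) * (3 * k)" by (rule mult_le_mono1) linarith
    then show ?thesis by (simp add: mult_ac)
  qed
  also have "\<dots> = (3 * a div 2) * (3 * b div 2)"
  proof -
    have "3 * b div 2 = 3 * k + 1" by (simp add: b)
    then show ?thesis by simp
  qed
  finally show ?thesis .
qed

text \<open>Compares the degree of \<open>G_(n^m)\<close> with the formal degree of an
  \<open>m\<close>-fold composition without cancellation.\<close>

lemma half_thrice_power_le:
  assumes "n \<ge> 1"
  shows "3 * n ^ m div 2 \<le> (3 * n div 2 :: nat) ^ m"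
proof (induction m)
  case (Suc m)
  have "3 * (n * n ^ m) div 2 \<le> (3 * n div 2) * (3 * n ^ m div 2)"
    using assms by (intro half_thrice_mult_le) simp_all
  also have "\<dots> \<le> (3 * n div 2) * (3 * n div 2) ^ m"
    using Suc by (rule mult_le_mono2)
  finally show ?case by simp
qed simp

lemma rmap_iterate_G:
  assumes "n \<ge> 1"
  shows "rmap_iterate m (hom_triple (3 * n div 2) (folding_G n)) =
    hom_triple ((3 * n div 2) ^ m)
      (folding_G (n ^ m) :: 'a::{alg_closed_field, field_char_0} poly2 \<times> 'a poly2)"
proof (induction m)
  case 0
  have "total_degree2 (var_x :: 'a poly2) \<le> 1" "total_degree2 (var_y :: 'a poly2) \<le> 1"
    using top_value_var_x[of "0 :: 'a" 0] top_value_var_y[of "0 :: 'a" 0]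
    by (simp_all add: top_value_def)
  \<comment> \<open>The formal degree is \<open>d^0 = 1\<close>, and \<open>G_1\<close> is the
    identity.\<close>
  then have "homogenize 1 var_x = monom3 (1 :: 'a) 1 0 0" "homogenize 1 var_y = monom3 (1 :: 'a) 0 1 0"
    by (auto intro!: poly3_eqI simp: eval3_homogenize simp del: One_nat_def)
  then show ?case
    by (simp add: rmap_iterate_def rmap_id_def hom_triple_def folding_G_def)
next
  case (Suc m)
  let ?d = "3 * n div 2"
  have deg: "total_degree2 (G_X var_x var_y (n ^ k) :: 'a poly2) \<le> ?d ^ k"
    "total_degree2 (G_Y var_x var_y (n ^ k) :: 'a poly2) \<le> ?d ^ k" for k
    using exact_degree_G[of "n ^ k", where 'a = 'a] half_thrice_power_le[OF assms, of k] assms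
    by (auto simp: exact_degree_def folding_G_def)
  have "rmap_iterate (Suc m) (hom_triple ?d (folding_G n)) =
      rmap_comp (hom_triple ?d (folding_G n)) (hom_triple (?d ^ m) (folding_G (n ^ m) :: 'a poly2 \<times> 'a poly2))"
    using Suc by (simp add: rmap_iterate_def)
  also have "\<dots> = hom_triple (?d * ?d ^ m) (folding_G (n ^ Suc m))"
    unfolding folding_G_def
    \<comment> \<open>Evaluating the polynomials at points turns the composition hypotheses into
      \<open>G_comp\<close>.\<close>
    by (rule rmap_comp_hom_triple)
      (use deg[of 1] deg[of m] deg[of "Suc m"] in
        \<open>simp_all add: eval2_G_X eval2_G_Y G_comp mult.commute\<close>)
  finally show ?case by simp
qed

lemma rmap_degree_iterate_G:
  assumes "n \<ge> 1"
  shows "rmap_degree (rmap_iterate m (hom_triple (3 * n div 2)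
    (folding_G n :: 'a::{alg_closed_field, field_char_0} poly2 \<times> 'a poly2))) = 3 * n ^ m div 2"
  unfolding rmap_iterate_G[OF assms]
  by (rule rmap_degree_hom_triple) (use assms in \<open>simp_all add: exact_degree_G half_thrice_power_le\<close>)

text \<open>The degree lies between \<open>n^m\<close> and \<open>2 n^m\<close>, and the
  \<open>m\<close>-th root of 2 tends to 1.\<close>

lemma root_half_thrice_power_tendsto:
  "(\<lambda>m. root m (real (3 * n ^ m div 2))) \<longlonglongrightarrow> real n"
proof (rule tendsto_sandwich[of "\<lambda>_. real n" _ _ "\<lambda>m. root m 2 * real n"])
  show "(\<lambda>m. root m 2 * real n) \<longlonglongrightarrow> real n"
    using tendsto_mult[OF LIMSEQ_root_const[of 2] tendsto_const, of "real n"] by simp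
  show "\<forall>\<^sub>F m in sequentially. real n \<le> root m (real (3 * n ^ m div 2))"
    \<comment> \<open>\<open>root 0\<close> is zero by convention, so the bounds are shown for
      \<open>m > 0\<close>.\<close>
    using eventually_gt_at_top[of 0]
  proof eventually_elim
    case (elim m)
    have "real (n ^ m) \<le> real (3 * n ^ m div 2)"
      by (subst of_nat_le_iff) linarith
    then have "root m (real n ^ m) \<le> root m (real (3 * n ^ m div 2))"
      using elim by (intro real_root_le_mono) simp_all
    then show ?case using elim by (simp add: real_root_power_cancel)
  qed
  show "\<forall>\<^sub>F m in sequentially. root m (real (3 * n ^ m div 2)) \<le> root m 2 * real n"
    using eventually_gt_at_top[of 0]
  proof eventually_elim
    case (elim m)
    have "real (3 * n ^ m div 2) \<le> real (2 * n ^ m)"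
      by (subst of_nat_le_iff) linarith
    then have "root m (real (3 * n ^ m div 2)) \<le> root m (2 * real n ^ m)"
      using elim by (intro real_root_le_mono) simp_all
    also have "\<dots> = root m 2 * real n"
      using elim by (simp add: real_root_mult real_root_power_cancel)
    finally show ?case .
  qed
qed simp

theorem theorem5p1:
  fixes n :: nat
    and A_bar B_bar G_bar :: "'a::{alg_closed_field, field_char_0} triple"
  assumes "n \<ge> 1"
    and "A_bar = homogenization (folding_A n)"
    and "B_bar = homogenization (folding_B n)"
    and "G_bar = homogenization (folding_G n)"
  shows "(is_morphism A_bar \<and> rmap_degree A_bar = n) \<and>
    (is_morphism B_bar \<and> rmap_degree B_bar = n) \<and>
    (rational_map G_bar \<and> int (rmap_degree G_bar) = \<lfloor>3 * real n / 2\<rfloor> \<and>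
      (n \<ge> 2 \<longrightarrow> \<not> is_morphism G_bar \<and>
        indeterminacy_locus G_bar =
          (if even n then {proj_point 0 1 0} else {proj_point 0 1 0, proj_point 1 0 0})) \<and>
      has_dynamical_degree G_bar (real n))"
proof (intro conjI impI)
  have A: "A_bar = hom_triple n (folding_A n)" and B: "B_bar = hom_triple n (folding_B n)"
    and G: "G_bar = hom_triple (3 * n div 2) (folding_G n)"
    using assms folding_A_nondegenerate(1) folding_B_nondegenerate(1) exact_degree_G homogenization_eq_hom_triple by metis+
  note eA = folding_A_nondegenerate(1)[OF assms(1), where 'a = 'a]
    and eB = folding_B_nondegenerate(1)[OF assms(1), where 'a = 'a]
    and eG = exact_degree_G[OF assms(1), where 'a = 'a]
  show "is_morphism A_bar" "is_morphism B_bar"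
    unfolding A B is_morphism_hom_triple_iff[OF eA] is_morphism_hom_triple_iff[OF eB]
    by (rule folding_A_nondegenerate folding_B_nondegenerate assms(1))+
  show "rmap_degree A_bar = n" "rmap_degree B_bar = n"
    unfolding A B by (rule rmap_degree_hom_triple eA eB order_refl)+
  show "rational_map G_bar" unfolding G by (rule rational_map_hom_triple[OF eG order_refl])
  show "int (rmap_degree G_bar) = \<lfloor>3 * real n / 2\<rfloor>"
    unfolding G rmap_degree_hom_triple[OF eG order_refl]
    using floor_divide_of_nat_eq[of "3 * n" 2, where 'a = real] by simp
  show "has_dynamical_degree G_bar (real n)"
    unfolding has_dynamical_degree_def G rmap_degree_iterate_G[OF assms(1)]
    by (rule root_half_thrice_power_tendsto)
  assume n: "n \<ge> 2"
  show "\<not> is_morphism G_bar"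
    unfolding G is_morphism_hom_triple_iff[OF eG] zero_locus_G[OF n] by simp
  show "indeterminacy_locus G_bar =
      (if even n then {proj_point 0 1 0} else {proj_point 0 1 0, proj_point 1 0 0})"
    unfolding G indeterminacy_locus_hom_triple[OF eG] by (rule zero_locus_G[OF n])
qed

end
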